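(* A graph $G$ is a special 2-threshold graph if and only if $G$ has no induced subgraph isomorphic to any of the following: $2K_2$, $C_5$, the net, the house, the gem, the octahedron, the 4-wheel with a pendant vertex adjacent to its center, or the diamond with a pendant vertex attached to each of its two vertices of degree three.
   Context: Graphs are finite and simple. Consider colorings of vertices with two colors, black ($b$) and white ($w$) (any map to $\{b,w\}$). A decomposition of a graph $G$ is a linear ordering $v_1,\ldots,v_n$ of its vertices together with a black/white coloring and, for each $j\ge 2$, an operator attached to $v_j$ chosen from $\oplus$, $\otimes_b$, $\otimes_w$, with the meaning: if the operator of $v_j$ is $\oplus$ then $v_j$ is adjacent to none of $v_1,\ldots,v_{j-1}$; if it is $\otimes_i$ ($i\in\{b,w\}$) then $v_j$ is adjacent to exactly those vertices among $v_1,\ldots,v_{j-1}$ that have color $i$. (Equivalently, a 2-threshold graph is one that admits such a decomposition.) A 2-threshold graph is special if it has a black-and-white coloring and such a decomposition using only $\oplus$- and $\otimes_w$-operators. Named graphs: $2K_2$ is two disjoint edges; $C_5$ is the 5-cycle; the net is a triangle with one pendant vertex attached to each of its three vertices; the house is a 4-cycle $[a,b,c,d]$ plus a vertex adjacent exactly to $a$ and $b$; the gem is a path $P_4$ plus a vertex adjacent to all four path vertices; the octahedron is $K_{2,2,2}$; the 4-wheel is a 4-cycle plus a center vertex adjacent to all four cycle vertices; the diamond is $K_4$ minus one edge. *)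

theory Defs
  imports "Graph_Theory.Graph_Theory"
begin

datatype colour = Black | White

datatype operator = Oplus | Otimes colour

text \<open>The ordering \<open>v\<^sub>1, \<dots>, v\<^sub>n\<close> is the list \<open>vs\<close>, so \<open>v\<^sub>j\<close> is \<open>vs ! (j - 1)\<close>.
  The first vertex carries no operator: the value of \<open>oper\<close> there is never inspected.\<close>

definition decomposition ::
  "('a, 'b) pre_digraph \<Rightarrow> 'a list \<Rightarrow> ('a \<Rightarrow> colour) \<Rightarrow> ('a \<Rightarrow> operator) \<Rightarrow> bool" where
  "decomposition G vs col oper \<longleftrightarrow>
     distinct vs \<and> set vs = verts G \<and>
     (\<forall>j. 1 \<le> j \<and> j < length vs \<longrightarrow>
        (case oper (vs ! j) of
           Oplus \<Rightarrow> \<forall>i<j. \<not> vs ! j \<rightarrow>\<^bsub>G\<^esub> vs ! i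
         | Otimes c \<Rightarrow> \<forall>i<j. vs ! j \<rightarrow>\<^bsub>G\<^esub> vs ! i \<longleftrightarrow> col (vs ! i) = c))"

definition two_threshold :: "('a, 'b) pre_digraph \<Rightarrow> bool" where
  "two_threshold G \<longleftrightarrow> (\<exists>vs col oper. decomposition G vs col oper)"

definition special_two_threshold :: "('a, 'b) pre_digraph \<Rightarrow> bool" where
  "special_two_threshold G \<longleftrightarrow>
     two_threshold G \<and>
     (\<exists>vs col oper. decomposition G vs col oper \<and>
        (\<forall>j. 1 \<le> j \<and> j < length vs \<longrightarrow> oper (vs ! j) \<in> {Oplus, Otimes White}))"

definition has_induced :: "('a, 'b) pre_digraph \<Rightarrow> ('c, 'd) pre_digraph \<Rightarrow> bool" where
  "has_induced G K \<longleftrightarrow> (\<exists>H. induced_subgraph H G \<and> digraph_iso H K)"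

text \<open>Undirected graphs are symmetric digraphs here, so every listed edge contributes both arcs.\<close>

definition graph_of_edges :: "nat \<Rightarrow> (nat \<times> nat) set \<Rightarrow> (nat, nat \<times> nat) pre_digraph" where
  "graph_of_edges n E = with_proj \<lparr>pverts = {..<n}, parcs = E \<union> E\<inverse>\<rparr>"

definition two_K2 :: "(nat, nat \<times> nat) pre_digraph" where
  "two_K2 = graph_of_edges 4 {(0,1), (2,3)}"

definition C5 :: "(nat, nat \<times> nat) pre_digraph" where
  "C5 = graph_of_edges 5 {(0,1), (1,2), (2,3), (3,4), (4,0)}"

definition net :: "(nat, nat \<times> nat) pre_digraph" where
  "net = graph_of_edges 6 {(0,1), (1,2), (2,0), (0,3), (1,4), (2,5)}"

definition house :: "(nat, nat \<times> nat) pre_digraph" where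
  "house = graph_of_edges 5 {(0,1), (1,2), (2,3), (3,0), (4,0), (4,1)}"

definition gem :: "(nat, nat \<times> nat) pre_digraph" where
  "gem = graph_of_edges 5 {(0,1), (1,2), (2,3), (4,0), (4,1), (4,2), (4,3)}"

text \<open>\<open>K\<^sub>2\<^sub>,\<^sub>2\<^sub>,\<^sub>2\<close> with parts \<open>{0, 1}\<close>, \<open>{2, 3}\<close>, \<open>{4, 5}\<close>.\<close>

definition octahedron :: "(nat, nat \<times> nat) pre_digraph" where
  "octahedron = graph_of_edges 6
     {(0,2), (0,3), (0,4), (0,5), (1,2), (1,3), (1,4), (1,5), (2,4), (2,5), (3,4), (3,5)}"

text \<open>Rim \<open>0, 1, 2, 3\<close>, centre \<open>4\<close>, pendant \<open>5\<close>.\<close>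

definition wheel4_pendant :: "(nat, nat \<times> nat) pre_digraph" where
  "wheel4_pendant = graph_of_edges 6
     {(0,1), (1,2), (2,3), (3,0), (4,0), (4,1), (4,2), (4,3), (4,5)}"

text \<open>The diamond is \<open>K\<^sub>4\<close> on \<open>0, 1, 2, 3\<close> minus the edge \<open>23\<close>; pendants \<open>4\<close>, \<open>5\<close>.\<close>

definition diamond_two_pendants :: "(nat, nat \<times> nat) pre_digraph" where
  "diamond_two_pendants = graph_of_edges 6
     {(0,1), (0,2), (0,3), (1,2), (1,3), (0,4), (1,5)}"

end

theory Submission
  imports Defs
begin

text \<open>
  Apart from isolated vertices, a special decomposition has three kinds of vertices: \<open>A\<close> (white,
  \<open>\<oplus>\<close>), \<open>D\<close> (black, \<open>\<otimes>\<^sub>w\<close>) and \<open>W\<close> (white, \<open>\<otimes>\<^sub>w\<close>). Here \<open>A\<close> and \<open>D\<close> are independent, \<open>W\<close> is a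
  clique, and adjacency decides which of two vertices of different kinds comes first. So \<open>G\<close> is
  special iff it has such a partition for which the resulting orientation of a complete tripartite
  graph is acyclic, which only requires the absence of directed 3-cycles and 4-cycles.

  If \<open>G\<close> has no induced 4-cycle, it is a split graph; its maximum clique serves as \<open>W\<close>, and the
  neighbourhoods of the remaining vertices form two chains living on disjoint parts of \<open>W\<close>.

  Otherwise the complement \<open>H\<close> contains two disjoint anticomplete edges. Enlarge them to a maximal
  anticomplete pair of sets \<open>C\<close>, \<open>C'\<close>, each with a dominating vertex. The other vertices are an
  independent set \<open>I\<close> anticomplete to \<open>C \<union> C'\<close>, and a clique \<open>K\<close> complete to \<open>I\<close>, each member of
  which is complete to exactly one of \<open>C\<close> and \<open>C'\<close>. Both \<open>C\<close> and \<open>C'\<close> induce threshold graphs of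
  \<open>H\<close>; their cliques, exchanged with the two halves of \<open>K\<close>, yield \<open>A\<close> and \<open>D\<close>.
\<close>

section \<open>Induced copies of small graphs\<close>

definition induced_copy :: "'a set \<Rightarrow> ('a \<Rightarrow> 'a \<Rightarrow> bool) \<Rightarrow> nat \<Rightarrow> (nat \<times> nat) set \<Rightarrow> (nat \<Rightarrow> 'a) \<Rightarrow> bool" where
  "induced_copy V E n F f \<longleftrightarrow>
     inj_on f {..<n} \<and> f ` {..<n} \<subseteq> V \<and>
     (\<forall>i<n. \<forall>j<n. E (f i) (f j) \<longleftrightarrow> (i, j) \<in> F \<union> F\<inverse>)"

text \<open>The inverse of the vertex map of the isomorphism is the embedding. Since
  \<open>H\<close> is induced, \<open>G\<close> and \<open>H\<close> have the same adjacency on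
  \<open>verts H\<close>.\<close>

lemma has_induced_imp_copy:
  fixes G :: "('a, 'b) pre_digraph"
  assumes "graph G" "has_induced G (graph_of_edges n F)"
  shows "\<exists>f. induced_copy (verts G) (\<lambda>x y. x \<rightarrow>\<^bsub>G\<^esub> y) n F f"
proof -
  interpret graph G by fact
  obtain H h where H: "induced_subgraph H G" and h: "pre_digraph.digraph_isomorphism H h"
    and eq: "graph_of_edges n F = app_iso h H"
    using assms(2) unfolding has_induced_def digraph_iso_def by blast
  interpret H: digraph H using H by (rule digraphI_induced)
  have hinj: "inj_on (iso_verts h) (verts H)"
    using h by (simp add: pre_digraph.digraph_isomorphism_def)
  have img: "iso_verts h ` verts H = {..<n}"
    using arg_cong[OF eq, of verts] by (simp add: graph_of_edges_def)
  have ends: "F \<union> F\<inverse> = (\<lambda>(u, v). (iso_verts h u, iso_verts h v)) ` arcs_ends H"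
    using arg_cong[OF eq, of arcs_ends] H.arcs_ends_app_iso_eq[OF h]
    by (simp add: graph_of_edges_def)
  have sub: "verts H \<subseteq> verts G" and tails: "tail H = tail G" "head H = head G"
    using H by (auto simp: induced_subgraph_def subgraph_def compatible_def)
  have adj: "u \<rightarrow>\<^bsub>G\<^esub> v \<longleftrightarrow> u \<rightarrow>\<^bsub>H\<^esub> v" if "u \<in> verts H" "v \<in> verts H" for u v
    using H that by (auto simp: induced_subgraph_def arcs_ends_conv tails)
  define f where "f = the_inv_into (verts H) (iso_verts h)"
  have fin: "f i \<in> verts H" "iso_verts h (f i) = i" if "i < n" for i
    using that hinj img unfolding f_def
    by (auto intro!: the_inv_into_into f_the_inv_into_f)
  have "induced_copy (verts G) (\<lambda>x y. x \<rightarrow>\<^bsub>G\<^esub> y) n F f"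
    unfolding induced_copy_def
  proof (intro conjI allI impI)
    show "inj_on f {..<n}" by (metis fin(2) inj_onI lessThan_iff)
    show "f ` {..<n} \<subseteq> verts G" using fin sub by auto
    fix i j assume ij: "i < n" "j < n"
    show "f i \<rightarrow>\<^bsub>G\<^esub> f j \<longleftrightarrow> (i, j) \<in> F \<union> F\<inverse>"
    proof
      assume "f i \<rightarrow>\<^bsub>G\<^esub> f j"
      then have "f i \<rightarrow>\<^bsub>H\<^esub> f j" using adj fin ij by blast
      then show "(i, j) \<in> F \<union> F\<inverse>" unfolding ends
        by (rule rev_image_eqI) (simp add: fin ij)
    next
      assume "(i, j) \<in> F \<union> F\<inverse>"
      then obtain u v where uv: "u \<rightarrow>\<^bsub>H\<^esub> v" "i = iso_verts h u" "j = iso_verts h v"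
        unfolding ends by auto
      then have "u \<in> verts H" "v \<in> verts H" by auto
      moreover from this have "f i = u" "f j = v"
        using uv hinj by (auto simp: f_def the_inv_into_f_f)
      ultimately show "f i \<rightarrow>\<^bsub>G\<^esub> f j" using adj uv by blast
    qed
  qed
  then show ?thesis by blast
qed

text \<open>Arcs of \<open>G\<close> are abstract, so the isomorphism must send each arc of the
  subgraph to the pair of indices of its ends. This is injective because a \<open>graph\<close> has
  no parallel arcs.\<close>

lemma copy_imp_has_induced:
  fixes G :: "('a, 'b) pre_digraph"
  assumes "graph G" and F: "F \<subseteq> {..<n} \<times> {..<n}"
    and copy: "induced_copy (verts G) (\<lambda>x y. x \<rightarrow>\<^bsub>G\<^esub> y) n F f"
  shows "has_induced G (graph_of_edges n F)"
proof -
  interpret graph G by fact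
  let ?S = "f ` {..<n}"
  define H where "H = G \<restriction> ?S"
  have inj: "inj_on f {..<n}" and S: "?S \<subseteq> verts G"
    and adj: "\<And>i j. i < n \<Longrightarrow> j < n \<Longrightarrow> f i \<rightarrow>\<^bsub>G\<^esub> f j \<longleftrightarrow> (i, j) \<in> F \<union> F\<inverse>"
    using copy by (auto simp: induced_copy_def)
  have ind: "induced_subgraph H G" unfolding H_def using S by (rule induced_induce)
  interpret H: digraph H using ind by (rule digraphI_induced)
  have Hs: "verts H = ?S" "tail H = tail G" "head H = head G"
    "arcs H = {e \<in> arcs G. tail G e \<in> ?S \<and> head G e \<in> ?S}"
    by (auto simp: H_def)
  define g where "g = the_inv_into {..<n} f"
  have g: "g (f i) = i" if "i < n" for i
    using inj that by (simp add: g_def the_inv_into_f_f)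
  define h where "h = \<lparr>iso_verts = g, iso_arcs = (\<lambda>e. (g (tail G e), g (head G e))),
    iso_head = snd, iso_tail = fst\<rparr>"
  have iso: "H.digraph_isomorphism h"
    unfolding H.digraph_isomorphism_def
  proof (intro conjI ballI)
    show "wf_digraph H" by unfold_locales
    show "inj_on (iso_verts h) (verts H)" by (auto simp: h_def Hs g intro!: inj_onI)
    show "inj_on (iso_arcs h) (arcs H)"
    proof (rule inj_onI)
      fix d e assume de: "d \<in> arcs H" "e \<in> arcs H" "iso_arcs h d = iso_arcs h e"
      then have "tail G d = tail G e" "head G d = head G e"
        by (auto simp: h_def Hs g)
      with de show "d = e" using no_multi_arcs[of d e] by (auto simp: Hs arc_to_ends_def)
    qed
  qed (auto simp: h_def Hs)
  have "iso_arcs h ` arcs H = F \<union> F\<inverse>"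
  proof (intro equalityI subsetI)
    fix p assume "p \<in> iso_arcs h ` arcs H"
    then obtain e i j where "e \<in> arcs G" "tail G e = f i" "head G e = f j" "i < n" "j < n"
      and "p = (i, j)" by (auto simp: Hs h_def g)
    moreover from this have "f i \<rightarrow>\<^bsub>G\<^esub> f j" by (auto simp: arcs_ends_conv intro!: rev_image_eqI)
    ultimately show "p \<in> F \<union> F\<inverse>" using adj by auto
  next
    fix p assume p: "p \<in> F \<union> F\<inverse>"
    then obtain i j where ij: "p = (i, j)" "i < n" "j < n" using F by auto
    with p have "f i \<rightarrow>\<^bsub>G\<^esub> f j" using adj by auto
    then obtain e where "e \<in> arcs G" "tail G e = f i" "head G e = f j" by auto
    then show "p \<in> iso_arcs h ` arcs H"
      using ij by (intro rev_image_eqI[of e]) (auto simp: Hs h_def g)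
  qed
  moreover have "g ` f ` {..<n} = {..<n}" using g by (force simp: image_image)
  ultimately have "graph_of_edges n F = app_iso h H"
    by (intro pre_digraph.equality) (auto simp: graph_of_edges_def h_def Hs with_proj_def)
  with ind iso show ?thesis unfolding has_induced_def digraph_iso_def by blast
qed

section \<open>Ordering a partition without short directed cycles\<close>

text \<open>A walk of two arcs between different parts shortcuts to one arc, and longer walks shrink
  likewise, so \<open>S\<close> is the transitive closure of \<open>R\<close> and is irreflexive. A
  vertex is ranked by its number of \<open>S\<close>-predecessors.\<close>

lemma multipartite_tournament_rank:
  fixes R :: "'a \<Rightarrow> 'a \<Rightarrow> bool" and part :: "'a \<Rightarrow> 'c"
  assumes fin: "finite V"
    and tot: "\<And>u v. \<lbrakk>u \<in> V; v \<in> V; part u \<noteq> part v\<rbrakk> \<Longrightarrow> R u v \<or> R v u"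
    and asym: "\<And>u v. \<lbrakk>R u v; R v u\<rbrakk> \<Longrightarrow> False"
    and prt: "\<And>u v. R u v \<Longrightarrow> u \<in> V \<and> v \<in> V \<and> part u \<noteq> part v"
    and no3: "\<And>u v w. \<lbrakk>R u v; R v w; R w u\<rbrakk> \<Longrightarrow> False"
    and no4: "\<And>u v w x. \<lbrakk>R u v; R v w; R w x; R x u; part u = part w; part v = part x\<rbrakk> \<Longrightarrow> False"
  shows "\<exists>f :: 'a \<Rightarrow> nat. \<forall>u v. R u v \<longrightarrow> f u < f v"
proof -
  have tr: "R u w" if "R u v" "R v w" "part u \<noteq> part w" for u v w
    using tot[of u w] prt[OF that(1)] prt[OF that(2)] that no3[of u v w] by blast
  define S where "S u v \<longleftrightarrow> R u v \<or> (part u = part v \<and> (\<exists>x. R u x \<and> R x v))" for u v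
  \<comment> \<open>If instead \<open>R w u\<close>, then either \<open>u\<close> and
    \<open>x\<close> share a part and a forbidden 4-cycle closes, or two uses of \<open>tr\<close>
    lead from \<open>u\<close> to \<open>x\<close> and on to \<open>w\<close>. \<open>SR\<close> is
    the mirror image.\<close>
  have RS: "R u w" if "R u v" "R v x" "R x w" "part v = part w" for u v x w
  proof (rule ccontr)
    assume n: "\<not> R u w"
    have p: "u \<in> V" "w \<in> V" "part u \<noteq> part w" using that prt[of u v] prt[of x w] by auto
    then have "R w u" using tot[of u w] n by blast
    moreover have "part u \<noteq> part x"
      using no4[OF that(1-3) \<open>R w u\<close>] that by auto
    ultimately show False using tr[of u v x] tr[of u x w] that n p by blast
  qed
  have SR: "R u w" if "R u x" "R x v" "R v w" "part u = part v" for u v x w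
  proof (rule ccontr)
    assume n: "\<not> R u w"
    have p: "u \<in> V" "w \<in> V" "part u \<noteq> part w" using that prt[of u x] prt[of v w] by auto
    then have "R w u" using tot[of u w] n by blast
    moreover have "part x \<noteq> part w"
      using no4[OF that(1-3) \<open>R w u\<close>] that by auto
    ultimately show False using tr[of x v w] tr[of u x w] that n p by blast
  qed
  have trans: "S u w" if "S u v" "S v w" for u v w
  proof -
    consider "R u v" "R v w" | x where "R u v" "R v x" "R x w" "part v = part w"
      | x where "R u x" "R x v" "R v w" "part u = part v"
      | x y where "R u x" "R x v" "part u = part v" "R v y" "R y w" "part v = part w"
      using \<open>S u v\<close> \<open>S v w\<close> unfolding S_def by blast
    then show ?thesis
    proof cases
      case 1 then show ?thesis using tr unfolding S_def by blast
    next
      case 2 then show ?thesis using RS unfolding S_def by blast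
    next
      case 3 then show ?thesis using SR unfolding S_def by blast
    next
      \<comment> \<open>Here \<open>u\<close>, \<open>v\<close>, \<open>w\<close> lie in one part;
        \<open>RS\<close> contracts the walk \<open>x\<close>, \<open>v\<close>, \<open>y\<close>,
        \<open>w\<close> to one arc, leaving the midpoint \<open>x\<close>.\<close>
      case 4 then show ?thesis using RS[of x v y w] unfolding S_def by auto
    qed
  qed
  have irr: "\<not> S u u" for u using asym prt unfolding S_def by blast
  have SV: "u \<in> V" if "S u v" for u v using that prt unfolding S_def by blast
  have "card {x. S x u} < card {x. S x v}" if "R u v" for u v
  proof (rule psubset_card_mono)
    show "finite {x. S x v}" using fin by (rule rev_finite_subset) (auto dest: SV)
    have "S u v" using that by (simp add: S_def)
    then show "{x. S x u} \<subset> {x. S x v}" using trans irr by blast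
  qed
  then show ?thesis by (intro exI[of _ "\<lambda>v. card {x. S x v}"]) blast
qed

text \<open>\<open>A\<close> collects the white \<open>\<oplus>\<close>-vertices, \<open>D\<close> the black and \<open>W\<close> the white
  \<open>\<otimes>\<^sub>w\<close>-vertices. Adjacency dictates the relative order of any two vertices of different
  parts; the last five conditions exclude directed triangles and directed 4-cycles.\<close>

locale special_partition =
  fixes E :: "'a \<Rightarrow> 'a \<Rightarrow> bool" and A D W :: "'a set"
  assumes disjoint: "A \<inter> D = {}" "A \<inter> W = {}" "D \<inter> W = {}"
    and indep_A: "\<lbrakk>x \<in> A; y \<in> A\<rbrakk> \<Longrightarrow> \<not> E x y"
    and indep_D: "\<lbrakk>x \<in> D; y \<in> D\<rbrakk> \<Longrightarrow> \<not> E x y"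
    and clique_W: "\<lbrakk>x \<in> W; y \<in> W; x \<noteq> y\<rbrakk> \<Longrightarrow> E x y"
    and no_cycle_AWD: "\<lbrakk>a \<in> A; d \<in> D; w \<in> W; E a w; E d w\<rbrakk> \<Longrightarrow> E a d"
    and no_cycle_ADW: "\<lbrakk>a \<in> A; d \<in> D; w \<in> W; E a d\<rbrakk> \<Longrightarrow> E a w \<or> E d w"
    and nested_AW: "\<lbrakk>a \<in> A; a' \<in> A; w \<in> W; w' \<in> W; E a w; E a' w'\<rbrakk> \<Longrightarrow> E a w' \<or> E a' w"
    and nested_DW: "\<lbrakk>d \<in> D; d' \<in> D; w \<in> W; w' \<in> W; E d w; E d' w'\<rbrakk> \<Longrightarrow> E d w' \<or> E d' w"
    and nested_AD: "\<lbrakk>a \<in> A; a' \<in> A; d \<in> D; d' \<in> D; E a d; E a' d'\<rbrakk> \<Longrightarrow> E a d' \<or> E a' d"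

section \<open>From a partition to a decomposition\<close>

text \<open>\<open>R u v\<close> means that \<open>u\<close> must precede \<open>v\<close>. A vertex
  of \<open>A\<close> is white with \<open>Oplus\<close>, so it is adjacent exactly to the later
  vertices of \<open>D\<close> and \<open>W\<close>; a vertex of \<open>D\<close> is black with
  \<open>Otimes White\<close>, so it is adjacent exactly to the earlier vertices of
  \<open>W\<close>.\<close>

lemma special_partition_rank:
  assumes fin: "finite (A \<union> D \<union> W)" and sym: "\<And>x y. E x y \<Longrightarrow> E y x"
    and sp: "special_partition E A D W"
  shows "\<exists>f :: 'a \<Rightarrow> nat.
    (\<forall>a\<in>A. \<forall>x\<in>D \<union> W. if E a x then f a < f x else f x < f a) \<and>
    (\<forall>w\<in>W. \<forall>d\<in>D. if E w d then f w < f d else f d < f w)"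
proof -
  have s: "E x y = E y x" for x y using sym by blast
  interpret special_partition E A D W by fact
  note dis = disjoint and t1 = no_cycle_AWD and t2 = no_cycle_ADW
    and q1 = nested_AW and q2 = nested_DW and q3 = nested_AD
  define R where "R u v \<longleftrightarrow>
    (u \<in> A \<and> v \<in> D \<union> W \<and> E u v) \<or> (u \<in> W \<and> v \<in> D \<and> E u v) \<or>
    (v \<in> A \<and> u \<in> D \<union> W \<and> \<not> E v u) \<or> (v \<in> W \<and> u \<in> D \<and> \<not> E v u)" for u v
  define part :: "'a \<Rightarrow> nat" where "part x = (if x \<in> A then 0 else if x \<in> D then 1 else 2)" for x
  have pA: "part x = 0" if "x \<in> A" for x using that by (simp add: part_def)
  have pD: "part x = 1" if "x \<in> D" for x using that dis by (auto simp: part_def)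
  have pW: "part x = 2" if "x \<in> W" for x using that dis by (auto simp: part_def)
  have RA: "R a x \<longleftrightarrow> E a x" "R x a \<longleftrightarrow> \<not> E a x" if "a \<in> A" "x \<in> D \<union> W" for a x
    using that dis unfolding R_def by auto
  have RW: "R w d \<longleftrightarrow> E w d" "R d w \<longleftrightarrow> \<not> E w d" if "w \<in> W" "d \<in> D" for w d
    using that dis unfolding R_def by auto
  have prt: "u \<in> A \<union> D \<union> W \<and> v \<in> A \<union> D \<union> W \<and> part u \<noteq> part v" if "R u v" for u v
    using that unfolding R_def by (auto simp: pA pD pW)
  have "\<exists>f :: 'a \<Rightarrow> nat. \<forall>u v. R u v \<longrightarrow> f u < f v"
  proof (rule multipartite_tournament_rank[OF fin, of part])
    fix u v assume "u \<in> A \<union> D \<union> W" "v \<in> A \<union> D \<union> W" "part u \<noteq> part v"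
    then consider "u \<in> A" "v \<in> D \<union> W" | "v \<in> A" "u \<in> D \<union> W" | "u \<in> D" "v \<in> W" | "u \<in> W" "v \<in> D"
      by (auto simp: pA pD pW)
    then show "R u v \<or> R v u" by cases (auto simp: RA RW)
  next
    fix u v assume R: "R u v" "R v u"
    then consider "u \<in> A" "v \<in> D \<union> W" | "v \<in> A" "u \<in> D \<union> W" | "u \<in> D" "v \<in> W" | "u \<in> W" "v \<in> D"
      using prt[OF R(1)] by (auto simp: pA pD pW)
    then show False using R by cases (simp_all add: RA RW)
  next
    fix u v assume "R u v"
    then show "u \<in> A \<union> D \<union> W \<and> v \<in> A \<union> D \<union> W \<and> part u \<noteq> part v" by (rule prt)
  next
    \<comment> \<open>A directed triangle uses all three parts, so it may be read from its vertex in
      \<open>A\<close>; the two ways round violate \<open>t1\<close> and \<open>t2\<close>.\<close>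
    have no3: False if R: "R a v" "R v w" "R w a" and "a \<in> A" for a v w
    proof -
      have vw: "v \<in> D \<union> W" "w \<in> D \<union> W"
        using prt[OF that(1)] prt[OF that(3)] that(4) pA by auto
      then have E: "E a v" "\<not> E a w" using that RA by auto
      consider "v \<in> W" "w \<in> D" | "v \<in> D" "w \<in> W"
        using vw prt[OF R(2)] pD pW by fastforce
      then show False
      proof cases
        case 1 then show False using t1[of a w v] that E RW[of v w] s by simp
      next
        case 2 then show False using t2[of a v w] that E RW[of w v] s by simp
      qed
    qed
    fix u v w assume R: "R u v" "R v w" "R w u"
    have "u \<in> A \<or> v \<in> A \<or> w \<in> A"
    proof (rule ccontr)
      assume "\<not> ?thesis"
      then have "part u \<in> {1, 2}" "part v \<in> {1, 2}" "part w \<in> {1, 2}" by (auto simp: part_def)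
      then show False using prt[OF R(1)] prt[OF R(2)] prt[OF R(3)] by auto
    qed
    then show False using no3 R by blast
  next
    fix u v w x assume R: "R u v" "R v w" "R w x" "R x u" and p: "part u = part w" "part v = part x"
    have pos: "part y = 0 \<Longrightarrow> y \<in> A" "part y = 1 \<Longrightarrow> y \<in> D" "part y = 2 \<Longrightarrow> y \<in> W"
      if "y \<in> A \<union> D \<union> W" for y using that by (auto simp: pA pD pW)
    have mem: "u \<in> A \<union> D \<union> W" "v \<in> A \<union> D \<union> W" "w \<in> A \<union> D \<union> W" "x \<in> A \<union> D \<union> W"
      "part u \<noteq> part v" using prt[OF R(1)] prt[OF R(3)] by auto
    have "part u = 0 \<or> part u = 1 \<or> part u = 2" "part v = 0 \<or> part v = 1 \<or> part v = 2"
      by (auto simp: part_def)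
    then consider "part u = 0" "part v = 1" | "part u = 0" "part v = 2" | "part u = 1" "part v = 0"
      | "part u = 1" "part v = 2" | "part u = 2" "part v = 0" | "part u = 2" "part v = 1"
      using mem(5) by fastforce
    then show False
    proof cases
      case 1
      then have "u \<in> A" "w \<in> A" "v \<in> D" "x \<in> D" using mem p pos by metis+
      then show False using q3[of u w v x] R by (simp add: RA)
    next
      case 2
      then have "u \<in> A" "w \<in> A" "v \<in> W" "x \<in> W" using mem p pos by metis+
      then show False using q1[of u w v x] R by (simp add: RA)
    next
      case 3
      then have "u \<in> D" "w \<in> D" "v \<in> A" "x \<in> A" using mem p pos by metis+
      then show False using q3[of v x w u] R by (simp add: RA)
    next
      case 4
      then have "u \<in> D" "w \<in> D" "v \<in> W" "x \<in> W" using mem p pos by metis+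
      then show False using q2[of w u v x] R by (simp add: RW s)
    next
      case 5
      then have "u \<in> W" "w \<in> W" "v \<in> A" "x \<in> A" using mem p pos by metis+
      then show False using q1[of v x w u] R by (simp add: RA)
    next
      case 6
      then have "u \<in> W" "w \<in> W" "v \<in> D" "x \<in> D" using mem p pos by metis+
      then show False using q2[of v x u w] R by (simp add: RW s)
    qed
  qed
  then obtain f :: "'a \<Rightarrow> nat" where f: "\<And>u v. R u v \<Longrightarrow> f u < f v" by blast
  show ?thesis
    by (intro exI[of _ f] conjI ballI) (auto intro!: f simp: R_def)
qed

text \<open>Sorting by the rank gives the ordering. Ties are harmless: vertices from different ones
  of \<open>A\<close>, \<open>D\<close>, \<open>W\<close> never have equal rank, and inside one of
  them, or with \<open>Z\<close> involved, adjacency does not depend on the order.\<close>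

lemma special_partition_imp_special:
  fixes G :: "('a, 'b) pre_digraph"
  assumes "graph G" and V: "verts G = A \<union> D \<union> W \<union> Z"
    and Z: "\<And>z x. z \<in> Z \<Longrightarrow> \<not> z \<rightarrow>\<^bsub>G\<^esub> x" "Z \<inter> (A \<union> D \<union> W) = {}"
    and sp: "special_partition (\<lambda>x y. x \<rightarrow>\<^bsub>G\<^esub> y) A D W"
  shows "special_two_threshold G"
proof -
  interpret graph G by fact
  have sym: "x \<rightarrow>\<^bsub>G\<^esub> y \<longleftrightarrow> y \<rightarrow>\<^bsub>G\<^esub> x" for x y
    using sym_arcs by (auto dest: arcs_ends_symmetric)
  have "finite (A \<union> D \<union> W)" using finite_verts V by simp
  from special_partition_rank[OF this _ sp] sym
  obtain f :: "'a \<Rightarrow> nat" where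
    f1: "\<And>a x. \<lbrakk>a \<in> A; x \<in> D \<union> W\<rbrakk> \<Longrightarrow> if a \<rightarrow>\<^bsub>G\<^esub> x then f a < f x else f x < f a" and
    f2: "\<And>w d. \<lbrakk>w \<in> W; d \<in> D\<rbrakk> \<Longrightarrow> if w \<rightarrow>\<^bsub>G\<^esub> d then f w < f d else f d < f w"
    by metis
  obtain xs where xs: "set xs = verts G" "distinct xs"
    using finite_distinct_list finite_verts by blast
  define vs where "vs = sort_key f xs"
  have vs: "set vs = verts G" "distinct vs" "sorted (map f vs)"
    using xs by (simp_all add: vs_def)
  \<comment> \<open>Vertices of \<open>Z\<close> become black with \<open>Oplus\<close>, hence
    isolated wherever they are placed.\<close>
  define col where "col x = (if x \<in> A \<union> W then White else Black)" for x
  define oper where "oper x = (if x \<in> D \<union> W then Otimes White else Oplus)" for x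
  interpret P: special_partition "\<lambda>x y. x \<rightarrow>\<^bsub>G\<^esub> y" A D W by fact
  note dis = P.disjoint and ind = P.indep_A P.indep_D P.clique_W
  have key: "y \<rightarrow>\<^bsub>G\<^esub> x \<longleftrightarrow> y \<in> D \<union> W \<and> x \<in> A \<union> W"
    if "x \<in> verts G" "y \<in> verts G" "x \<noteq> y" "f x \<le> f y" for x y
  proof -
    have "x \<in> A \<union> D \<union> W \<union> Z" "y \<in> A \<union> D \<union> W \<union> Z" using that V by auto
    then consider "x \<in> Z" | "y \<in> Z" | "x \<in> A" "y \<in> A" | "x \<in> D" "y \<in> D" | "x \<in> W" "y \<in> W"
      | "x \<in> A" "y \<in> D \<union> W" | "y \<in> A" "x \<in> D \<union> W" | "x \<in> W" "y \<in> D" | "x \<in> D" "y \<in> W"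
      by blast
    then show ?thesis
    proof cases
      case 1 then show ?thesis using Z(1)[of x y] sym[of x y] Z(2) by auto
    next
      case 2 then show ?thesis using Z by blast
    next
      case 3 then show ?thesis using ind dis by blast
    next
      case 4 then show ?thesis using ind dis by blast
    next
      case 5 then show ?thesis using ind that by blast
    next
      case 6 then show ?thesis using f1[of x y] that sym[of x y] by (auto split: if_splits)
    next
      case 7 then show ?thesis using f1[of y x] that sym[of x y] dis by (auto split: if_splits)
    next
      case 8 then show ?thesis using f2[of x y] that sym[of x y] dis by (auto split: if_splits)
    next
      case 9 then show ?thesis using f2[of y x] that sym[of x y] dis by (auto split: if_splits)
    qed
  qed
  have key': "vs ! j \<rightarrow>\<^bsub>G\<^esub> vs ! i \<longleftrightarrow> vs ! j \<in> D \<union> W \<and> vs ! i \<in> A \<union> W"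
    if "i < j" "j < length vs" for i j
  proof (rule key)
    show "vs ! i \<in> verts G" "vs ! j \<in> verts G" using that vs(1) nth_mem by force+
    show "vs ! i \<noteq> vs ! j" using that vs(2) by (simp add: nth_eq_iff_index_eq)
    show "f (vs ! i) \<le> f (vs ! j)" using that sorted_nth_mono[OF vs(3), of i j] by simp
  qed
  have "decomposition G vs col oper"
    unfolding decomposition_def using vs
    by (auto simp: key' oper_def col_def split: operator.split)
  moreover have "\<forall>j. oper (vs ! j) \<in> {Oplus, Otimes White}" by (simp add: oper_def)
  ultimately show ?thesis unfolding special_two_threshold_def two_threshold_def by blast
qed

section \<open>Graphs without induced 4-cycles\<close>

lemma finite_has_max_image:
  fixes f :: "'b \<Rightarrow> nat"
  assumes "finite S" "S \<noteq> {}"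
  shows "\<exists>x\<in>S. \<forall>y\<in>S. f y \<le> f x"
proof -
  have "Max (f ` S) \<in> f ` S" using assms by simp
  then obtain x where "x \<in> S" "f x = Max (f ` S)" by (metis imageE)
  with assms show ?thesis by (metis Max_ge finite_imageI imageI)
qed

text \<open>The theorem of Foeldes and Hammer. Among the maximum cliques one of largest degree sum
  is taken: an edge outside of it would allow an exchange that increases this sum.\<close>

lemma split_graph_partition:
  fixes E :: "'a \<Rightarrow> 'a \<Rightarrow> bool"
  assumes fin: "finite V" and sym: "\<And>x y. E x y \<Longrightarrow> E y x" and irr: "\<And>x. \<not> E x x"
    and no_2K2: "\<And>a b c d. \<lbrakk>a \<in> V; b \<in> V; c \<in> V; d \<in> V; E a b; E c d;
      \<not> E a c; \<not> E a d; \<not> E b c; \<not> E b d\<rbrakk> \<Longrightarrow> False"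
    and no_C4: "\<And>a b c d. \<lbrakk>a \<in> V; b \<in> V; c \<in> V; d \<in> V; E a b; E b c; E c d; E d a;
      \<not> E a c; \<not> E b d; a \<noteq> c; b \<noteq> d\<rbrakk> \<Longrightarrow> False"
    and no_C5: "\<And>a b c d e. \<lbrakk>a \<in> V; b \<in> V; c \<in> V; d \<in> V; e \<in> V; E a b; E b c; E c d; E d e; E e a;
      \<not> E a c; \<not> E a d; \<not> E b d; \<not> E b e; \<not> E c e\<rbrakk> \<Longrightarrow> False"
  shows "\<exists>K\<subseteq>V. (\<forall>x\<in>K. \<forall>y\<in>K. x \<noteq> y \<longrightarrow> E x y) \<and> (\<forall>x\<in>V - K. \<forall>y\<in>V - K. \<not> E x y) \<and>
    (\<forall>x\<in>V - K. \<exists>y\<in>K. \<not> E x y)"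
proof -
  define clique where "clique K \<longleftrightarrow> K \<subseteq> V \<and> (\<forall>x\<in>K. \<forall>y\<in>K. x \<noteq> y \<longrightarrow> E x y)" for K
  define N where "N x = {y \<in> V. E x y}" for x
  have "finite (Collect clique)"
    by (rule finite_subset[of _ "Pow V"]) (auto simp: clique_def fin)
  moreover have "Collect clique \<noteq> {}" by (auto simp: clique_def intro: exI[of _ "{}"])
  ultimately have "\<exists>K\<in>Collect clique. \<forall>K'\<in>Collect clique. card K' \<le> card K"
    by (rule finite_has_max_image)
  then obtain K0 where K0: "clique K0" "\<And>K. clique K \<Longrightarrow> card K \<le> card K0" by auto
  let ?S = "{K. clique K \<and> card K = card K0}" and ?d = "\<lambda>K. \<Sum>x\<in>K. card (N x)"
  have "finite ?S"
    using \<open>finite (Collect clique)\<close> by (rule rev_finite_subset) auto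
  moreover have "?S \<noteq> {}" using K0(1) by auto
  ultimately have "\<exists>K\<in>?S. \<forall>K'\<in>?S. ?d K' \<le> ?d K"
    by (rule finite_has_max_image)
  then obtain K where K: "clique K" "card K = card K0"
    and degs: "\<And>K'. \<lbrakk>clique K'; card K' = card K0\<rbrakk> \<Longrightarrow> ?d K' \<le> ?d K"
    by auto
  have maxK: "card K' \<le> card K" if "clique K'" for K' using K0(2) K(2) that by simp
  have finK: "finite K" using K(1) fin by (auto simp: clique_def intro: finite_subset)
  have KV: "K \<subseteq> V" and Kcl: "\<And>x y. \<lbrakk>x \<in> K; y \<in> K; x \<noteq> y\<rbrakk> \<Longrightarrow> E x y"
    using K(1) by (auto simp: clique_def)
  have nonnbr: "\<exists>y\<in>K. \<not> E x y" if "x \<in> V - K" for x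
  proof (rule ccontr)
    assume "\<not> ?thesis"
    then have "clique (insert x K)" using K(1) that sym by (auto simp: clique_def)
    then show False using maxK[of "insert x K"] that finK by simp
  qed
  \<comment> \<open>The case of comparable non-neighbourhoods: \<open>p\<close> is then the only
    vertex of \<open>K\<close> missed by \<open>x\<close>, since a second one would give an edge at
    \<open>p\<close> anticomplete to the edge between \<open>x\<close> and \<open>y\<close>.\<close>
  have nested: False if xy: "x \<in> V - K" "y \<in> V - K" "E x y"
    and sub: "\<And>z. \<lbrakk>z \<in> K; \<not> E x z\<rbrakk> \<Longrightarrow> \<not> E y z" for x y
  proof -
    obtain p where p: "p \<in> K" "\<not> E x p" using nonnbr xy by blast
    have xK: "E x z" if "z \<in> K" "z \<noteq> p" for z
      using no_2K2[of x y p z] xy sub that p Kcl[of p z] KV by blast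
    \<comment> \<open>Otherwise replacing \<open>p\<close> by both \<open>x\<close> and
      \<open>y\<close> would give a larger clique.\<close>
    obtain q where q: "q \<in> K" "q \<noteq> p" "\<not> E y q"
    proof (rule ccontr)
      assume "\<not> thesis"
      then have "\<And>z. z \<in> K \<Longrightarrow> z \<noteq> p \<Longrightarrow> E y z" using that by blast
      then have "clique (insert x (insert y (K - {p})))"
        using Kcl xK xy sym KV by (auto simp: clique_def)
      moreover have "x \<noteq> y" using xy irr by blast
      moreover have "card K > 0" using p finK by (auto simp: card_gt_0_iff)
      ultimately show False using maxK[of "insert x (insert y (K - {p}))"] xy finK p by simp
    qed
    \<comment> \<open>Exchanging \<open>p\<close> for \<open>x\<close> gives another maximum clique,
      so the choice of \<open>K\<close> by degree sum bounds the degree of \<open>x\<close> by that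
      of \<open>p\<close>. As \<open>y\<close> is adjacent to \<open>x\<close> but not to
      \<open>p\<close>, some \<open>z\<close> is adjacent to \<open>p\<close> but not to
      \<open>x\<close>.\<close>
    have "clique (insert x (K - {p}))" using Kcl xK xy sym KV by (auto simp: clique_def)
    moreover have "card (insert x (K - {p})) = card K"
      using xy finK card_Suc_Diff1[OF finK p(1)] by simp
    ultimately have "(\<Sum>x\<in>insert x (K - {p}). card (N x)) \<le> (\<Sum>x\<in>K. card (N x))"
      using degs K(2) by simp
    moreover have "(\<Sum>x\<in>K. card (N x)) = card (N p) + (\<Sum>x\<in>K - {p}. card (N x))"
      using finK p by (simp add: sum.remove)
    ultimately have le: "card (N x) \<le> card (N p)" using xy finK by simp
    have "\<not> N p \<subset> N x"
      using le psubset_card_mono[of "N x" "N p"] fin by (auto simp: N_def)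
    moreover have "y \<in> N x" "y \<notin> N p" using xy p sub[of p] sym by (auto simp: N_def)
    ultimately obtain z where z: "z \<in> V" "E p z" "\<not> E x z" by (auto simp: N_def)
    have zy: "E y z"
      using no_2K2[of x y p z] xy z p sub[of p] KV by blast
    have qs: "E x q" "E q p" "E q x" using xK q Kcl p sym by auto
    have xz: "x \<noteq> z" using z(2) p(2) sym by blast
    \<comment> \<open>The path \<open>x\<close>, \<open>y\<close>, \<open>z\<close> is closed by
      \<open>q\<close> to a 4-cycle, or by \<open>p\<close> and \<open>q\<close> to a
      5-cycle.\<close>
    show False
    proof (cases "E z q")
      case True
      then show False
        using no_C4[of x y z q] xy z q zy qs xz KV by blast
    next
      case False
      then show False
        using no_C5[of x y z p q] xy z q zy qs p KV sym sub[of p] by blast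
    qed
  qed
  have indep: "\<not> E x y" if xy: "x \<in> V - K" "y \<in> V - K" for x y
  proof
    assume E: "E x y"
    \<comment> \<open>By \<open>nested\<close> in both directions the non-neighbourhoods are
      incomparable; the witnesses \<open>p\<close> and \<open>q\<close> close a 4-cycle with
      \<open>x\<close> and \<open>y\<close>.\<close>
    obtain p where p: "p \<in> K" "\<not> E x p" "E y p" using nested[of x y] xy E by blast
    obtain q where q: "q \<in> K" "\<not> E y q" "E x q" using nested[of y x] xy sym[OF E] by blast
    have "p \<noteq> q" using p q by blast
    then show False using no_C4[of x y p q] xy E p q Kcl[of p q] KV sym by blast
  qed
  show ?thesis
    by (intro exI[of _ K] conjI ballI impI KV Kcl indep nonnbr)
qed

section \<open>The eight patterns as conditions on an adjacency relation\<close>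

text \<open>Distinctness is assumed only for nonadjacent vertices with the same neighbours in the
  pattern; for all other pairs the adjacencies force it.\<close>

locale special_free =
  fixes E :: "'a \<Rightarrow> 'a \<Rightarrow> bool" and V :: "'a set"
  assumes fin: "finite V" and sym: "E x y \<Longrightarrow> E y x" and irr: "\<not> E x x"
    and no_2K2: "\<lbrakk>{a, b, c, d} \<subseteq> V; E a b; E c d; \<not> E a c; \<not> E a d; \<not> E b c; \<not> E b d\<rbrakk> \<Longrightarrow> False"
    and no_C5: "\<lbrakk>{a, b, c, d, e} \<subseteq> V; E a b; E b c; E c d; E d e; E e a;
      \<not> E a c; \<not> E a d; \<not> E b d; \<not> E b e; \<not> E c e\<rbrakk> \<Longrightarrow> False"
    and no_net: "\<lbrakk>{a, b, c, x, y, z} \<subseteq> V; E a b; E b c; E a c; E a x; E b y; E c z;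
      \<not> E a y; \<not> E a z; \<not> E b x; \<not> E b z; \<not> E c x; \<not> E c y; \<not> E x y; \<not> E x z; \<not> E y z\<rbrakk> \<Longrightarrow> False"
    and no_house: "\<lbrakk>{a, b, c, d, e} \<subseteq> V; E a b; E b c; E c d; E d a; E e a; E e b;
      \<not> E a c; \<not> E b d; \<not> E e c; \<not> E e d\<rbrakk> \<Longrightarrow> False"
    and no_gem: "\<lbrakk>{a, b, c, d, e} \<subseteq> V; E a b; E b c; E c d; E e a; E e b; E e c; E e d;
      \<not> E a c; \<not> E a d; \<not> E b d\<rbrakk> \<Longrightarrow> False"
    and no_octahedron: "\<lbrakk>{a, a', b, b', c, c'} \<subseteq> V; a \<noteq> a'; b \<noteq> b'; c \<noteq> c';
      E a b; E a b'; E a c; E a c'; E a' b; E a' b'; E a' c; E a' c'; E b c; E b c'; E b' c; E b' c';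
      \<not> E a a'; \<not> E b b'; \<not> E c c'\<rbrakk> \<Longrightarrow> False"
    and no_wheel: "\<lbrakk>{a, b, c, d, e, p} \<subseteq> V; a \<noteq> c; b \<noteq> d; E a b; E b c; E c d; E d a;
      E e a; E e b; E e c; E e d; E e p; \<not> E a c; \<not> E b d;
      \<not> E a p; \<not> E b p; \<not> E c p; \<not> E d p\<rbrakk> \<Longrightarrow> False"
    and no_diamond: "\<lbrakk>{a, b, c, d, p, q} \<subseteq> V; c \<noteq> d; E a b; E a c; E a d; E b c; E b d; E a p; E b q;
      \<not> E c d; \<not> E a q; \<not> E b p; \<not> E c p; \<not> E c q; \<not> E d p; \<not> E d q; \<not> E p q\<rbrakk> \<Longrightarrow> False"
begin

lemma sym_iff: "E x y \<longleftrightarrow> E y x"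
  using sym by blast

text \<open>If \<open>G\<close> has no 4-cycle then it is a split graph. The neighbourhoods of the independent
  vertices in the clique are pairwise nested or disjoint (gem), meeting is transitive
  (diamond with pendants) and has at most two classes (net): these are \<open>A\<close> and \<open>D\<close>.\<close>

lemma special_partition_no_C4:
  assumes no_C4: "\<And>a b c d. \<lbrakk>a \<in> V; b \<in> V; c \<in> V; d \<in> V; E a b; E b c; E c d; E d a;
      \<not> E a c; \<not> E b d; a \<noteq> c; b \<noteq> d\<rbrakk> \<Longrightarrow> False"
    and noiso: "\<And>x. x \<in> V \<Longrightarrow> \<exists>y\<in>V. E x y"
  shows "\<exists>A D W. V = A \<union> D \<union> W \<and> special_partition E A D W"
proof -
  have "\<exists>K\<subseteq>V. (\<forall>x\<in>K. \<forall>y\<in>K. x \<noteq> y \<longrightarrow> E x y) \<and> (\<forall>x\<in>V - K. \<forall>y\<in>V - K. \<not> E x y) \<and>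
    (\<forall>x\<in>V - K. \<exists>y\<in>K. \<not> E x y)"
  proof (rule split_graph_partition[OF fin])
    show False if "a \<in> V" "b \<in> V" "c \<in> V" "d \<in> V" "E a b" "E c d"
      "\<not> E a c" "\<not> E a d" "\<not> E b c" "\<not> E b d" for a b c d
      using that no_2K2[of a b c d] by simp
    show False if "a \<in> V" "b \<in> V" "c \<in> V" "d \<in> V" "e \<in> V" "E a b" "E b c" "E c d" "E d e" "E e a"
      "\<not> E a c" "\<not> E a d" "\<not> E b d" "\<not> E b e" "\<not> E c e" for a b c d e
      using that no_C5[of a b c d e] by simp
  qed (fact sym irr no_C4)+
  then obtain K where KV: "K \<subseteq> V" and K: "\<forall>x\<in>K. \<forall>y\<in>K. x \<noteq> y \<longrightarrow> E x y"
    "\<forall>x\<in>V - K. \<forall>y\<in>V - K. \<not> E x y" "\<forall>x\<in>V - K. \<exists>y\<in>K. \<not> E x y"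
    by blast
  have Kcl: "E x y" if "x \<in> K" "y \<in> K" "x \<noteq> y" for x y using K(1) that by blast
  have ind: "\<not> E x y" if "x \<in> V - K" "y \<in> V - K" for x y using K(2) that by blast
  have nonnbr: "\<exists>y\<in>K. \<not> E x y" if "x \<in> V - K" for x using K(3) that by blast
  define I where "I = V - K"
  define meet where "meet x y \<longleftrightarrow> (\<exists>k\<in>K. E x k \<and> E y k)" for x y
  have IV: "x \<in> V" "x \<notin> K" if "x \<in> I" for x using that by (auto simp: I_def)
  have KV': "k \<in> V" if "k \<in> K" for k using that KV by blast
  have nbr: "\<exists>k\<in>K. E x k" if "x \<in> I" for x
    using noiso[of x] ind[of x] that by (auto simp: I_def)
  have indI: "\<not> E x y" if "x \<in> I" "y \<in> I" for x y using ind that by (auto simp: I_def)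
  have meet_sym: "meet x y \<longleftrightarrow> meet y x" for x y by (auto simp: meet_def)
  \<comment> \<open>Private neighbours \<open>k\<close>, \<open>k'\<close> of the two vertices and a
    common neighbour \<open>m\<close> form a gem with centre \<open>m\<close>.\<close>
  have nested: "E x k' \<or> E y k" if h: "x \<in> I" "y \<in> I" "meet x y" "k \<in> K" "k' \<in> K" "E x k" "E y k'" for x y k k'
  proof (rule ccontr)
    assume n: "\<not> ?thesis"
    obtain m where m: "m \<in> K" "E x m" "E y m" using h by (auto simp: meet_def)
    have "m \<noteq> k" "m \<noteq> k'" "k \<noteq> k'" using n m h by blast+
    then show False
      using no_gem[of x k k' y m] n m h Kcl[of k k'] Kcl[of m k] Kcl[of m k'] indI[of x y] sym_iff IV KV'
      by simp
  qed
  have trans: "meet x z" if h: "x \<in> I" "y \<in> I" "z \<in> I" "meet x y" "meet y z" for x y z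
  proof (rule ccontr)
    assume n: "\<not> ?thesis"
    then have dj: "\<not> (E x k \<and> E z k)" if "k \<in> K" for k using that by (auto simp: meet_def)
    obtain k where k: "k \<in> K" "E x k" "E y k" using h by (auto simp: meet_def)
    obtain k' where k': "k' \<in> K" "E y k'" "E z k'" using h by (auto simp: meet_def)
    \<comment> \<open>No outside vertex is complete to \<open>K\<close>, so \<open>m\<close> exists.
      By \<open>nested\<close>, \<open>x\<close> and \<open>z\<close> miss it as well, and
      \<open>k\<close>, \<open>k'\<close>, \<open>y\<close>, \<open>m\<close> form a diamond with
      pendants \<open>x\<close> and \<open>z\<close> at \<open>k\<close> and
      \<open>k'\<close>.\<close>
    obtain m where m: "m \<in> K" "\<not> E y m" using nonnbr \<open>y \<in> I\<close> by (auto simp: I_def)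
    have "\<not> E x k'" "\<not> E z k" using dj[of k] dj[of k'] k k' by auto
    moreover from this have "\<not> E x m" "\<not> E z m"
      using nested[of x y m k'] nested[of z y m k] h m k k' meet_sym by blast+
    moreover have "k \<noteq> k'" "m \<noteq> k" "m \<noteq> k'" "m \<noteq> y" using k k' m calculation IV \<open>y \<in> I\<close> by blast+
    ultimately show False
      using no_diamond[of k k' y m x z] k k' m h Kcl[of k k'] Kcl[of m k] Kcl[of m k']
        indI[of x y] indI[of y z] indI[of x z] sym_iff IV KV' by simp
  qed
  have two: "meet y z" if h: "x \<in> I" "y \<in> I" "z \<in> I" "\<not> meet x y" "\<not> meet x z" for x y z
  proof (rule ccontr)
    assume n: "\<not> ?thesis"
    obtain k l m where klm: "k \<in> K" "E x k" "l \<in> K" "E y l" "m \<in> K" "E z m"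
      using nbr h by meson
    then have "\<not> E x l" "\<not> E x m" "\<not> E y k" "\<not> E y m" "\<not> E z k" "\<not> E z l"
      using h n by (auto simp: meet_def)
    moreover from this have "k \<noteq> l" "k \<noteq> m" "l \<noteq> m" using klm by blast+
    ultimately show False
      using no_net[of k l m x y z] klm h Kcl[of k l] Kcl[of k m] Kcl[of l m]
        indI[of x y] indI[of y z] indI[of x z] sym_iff IV KV' by simp
  qed
  show ?thesis
  proof (cases "I = {}")
    case True
    then have "V = {} \<union> {} \<union> K" using KV by (auto simp: I_def)
    moreover have "special_partition E {} {} K" using Kcl by unfold_locales auto
    ultimately show ?thesis by blast
  next
    case False
    then obtain i where i: "i \<in> I" by blast
    define A where "A = {x \<in> I. meet i x}"
    define D where "D = {x \<in> I. \<not> meet i x}"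
    have AD: "\<not> meet a d" if "a \<in> A" "d \<in> D" for a d
      using that trans[of i a d] i by (auto simp: A_def D_def)
    have AA: "meet a a'" if "a \<in> A" "a' \<in> A" for a a'
      using that trans[of a i a'] i meet_sym by (auto simp: A_def)
    have DD: "meet d d'" if "d \<in> D" "d' \<in> D" for d d'
      using that two[of i d d'] i by (auto simp: D_def)
    have AI: "x \<in> I" if "x \<in> A" for x using that by (simp add: A_def)
    have DI: "x \<in> I" if "x \<in> D" for x using that by (simp add: D_def)
    have "special_partition E A D K"
    proof
      show "A \<inter> D = {}" "A \<inter> K = {}" "D \<inter> K = {}" by (auto simp: A_def D_def I_def)
    next
      fix a d w assume "a \<in> A" "d \<in> D" "w \<in> K" "E a w" "E d w"
      then show "E a d" using AD[of a d] by (auto simp: meet_def)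
    next
      fix a a' w w' assume "a \<in> A" "a' \<in> A" "w \<in> K" "w' \<in> K" "E a w" "E a' w'"
      then show "E a w' \<or> E a' w" using nested[of a a' w w'] AA AI by blast
    next
      fix a a' w w' assume "a \<in> D" "a' \<in> D" "w \<in> K" "w' \<in> K" "E a w" "E a' w'"
      then show "E a w' \<or> E a' w" using nested[of a a' w w'] DD DI by blast
    next
      fix a d w assume "a \<in> A" "d \<in> D" "E a d"
      then show "E a w \<or> E d w" using indI[of a d] AI DI by simp
    next
      fix a a' d d' assume "a \<in> A" "d \<in> D" "E a d"
      then show "E a d' \<or> E a' d" using indI[of a d] AI DI by simp
    next
      show "\<not> E x y" if "x \<in> A" "y \<in> A" for x y using that indI AI by simp
      show "\<not> E x y" if "x \<in> D" "y \<in> D" for x y using that indI DI by simp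
    qed (fact Kcl)
    moreover have "V = A \<union> D \<union> K" using KV by (auto simp: A_def D_def I_def)
    ultimately show ?thesis by blast
  qed
qed

end

section \<open>Graphs with an induced 4-cycle\<close>

text \<open>\<open>H\<close> is the complement of the graph of interest. The conditions below say that \<open>C \<union> K\<close> can be
  ordered such that every \<open>k \<in> K\<close> is \<open>H\<close>-adjacent to precisely the later vertices of \<open>C\<close>, and every
  \<open>w \<in> W\<close> to precisely the later vertices of \<open>A\<close>.\<close>

locale side_partition =
  fixes H :: "'a \<Rightarrow> 'a \<Rightarrow> bool" and C K A W :: "'a set"
  assumes C_eq: "C = A \<union> W" and disj: "A \<inter> W = {}"
    and clique_A: "\<lbrakk>x \<in> A; y \<in> A; x \<noteq> y\<rbrakk> \<Longrightarrow> H x y"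
    and indep_W: "\<lbrakk>x \<in> W; y \<in> W\<rbrakk> \<Longrightarrow> \<not> H x y"
    and nested_AW: "\<lbrakk>a \<in> A; a' \<in> A; w \<in> W; w' \<in> W; H a w; H a' w'\<rbrakk> \<Longrightarrow> H a w' \<or> H a' w"
    and closed_A: "\<lbrakk>k \<in> K; w \<in> W; a \<in> A; H k w; H a w\<rbrakk> \<Longrightarrow> H k a"
    and closed_W: "\<lbrakk>k \<in> K; w \<in> W; a \<in> A; H k a\<rbrakk> \<Longrightarrow> H a w \<or> H k w"
    and nested_K: "\<lbrakk>k \<in> K; l \<in> K; x \<in> C; y \<in> C; H k x; H l y\<rbrakk> \<Longrightarrow> H k y \<or> H l x"

text \<open>The patterns of \<open>special_free\<close> complemented: two disjoint edges become the
  4-cycle, the 5-cycle stays, the house becomes the path on five vertices, the net the 3-sun, the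
  gem a path on four vertices plus an isolated vertex, the octahedron three disjoint edges, the
  wheel a butterfly plus an isolated vertex (its hub), the diamond a 4-clique with two
  pendants.\<close>

locale co_special_free =
  fixes H :: "'a \<Rightarrow> 'a \<Rightarrow> bool" and V :: "'a set"
  assumes fin: "finite V" and sym: "H x y \<Longrightarrow> H y x" and irr: "\<not> H x x"
    and no_C4: "\<lbrakk>{a, b, c, d} \<subseteq> V; H a b; H b c; H c d; H d a; \<not> H a c; \<not> H b d; a \<noteq> c; b \<noteq> d\<rbrakk> \<Longrightarrow> False"
    and no_C5: "\<lbrakk>{a, b, c, d, e} \<subseteq> V; H a b; H b c; H c d; H d e; H e a;
      \<not> H a c; \<not> H a d; \<not> H b d; \<not> H b e; \<not> H c e\<rbrakk> \<Longrightarrow> False"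
    and no_P5: "\<lbrakk>{a, b, c, d, e} \<subseteq> V; H a b; H b c; H c d; H d e;
      \<not> H a c; \<not> H a d; \<not> H a e; \<not> H b d; \<not> H b e; \<not> H c e\<rbrakk> \<Longrightarrow> False"
    and no_sun: "\<lbrakk>{u, k, l, x, y, z} \<subseteq> V; H u k; H u l; H k l; H x u; H x k; H y u; H y l; H z k; H z l;
      \<not> H x l; \<not> H y k; \<not> H z u; \<not> H x y; \<not> H x z; \<not> H y z\<rbrakk> \<Longrightarrow> False"
    and no_cogem: "\<lbrakk>{a, b, c, d, v} \<subseteq> V; H a b; H b c; H c d; \<not> H a c; \<not> H a d; \<not> H b d;
      \<not> H a v; \<not> H b v; \<not> H c v; \<not> H d v\<rbrakk> \<Longrightarrow> False"
    and no_3K2: "\<lbrakk>{a, a', b, b', c, c'} \<subseteq> V; H a a'; H b b'; H c c'; \<not> H a b; \<not> H a b'; \<not> H a c; \<not> H a c';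
      \<not> H a' b; \<not> H a' b'; \<not> H a' c; \<not> H a' c'; \<not> H b c; \<not> H b c'; \<not> H b' c; \<not> H b' c'\<rbrakk> \<Longrightarrow> False"
    and no_butterfly: "\<lbrakk>{a, b, c, d, k, v} \<subseteq> V; H a b; H c d; H k a; H k b; H k c; H k d;
      \<not> H a c; \<not> H a d; \<not> H b c; \<not> H b d; \<not> H v a; \<not> H v b; \<not> H v c; \<not> H v d; \<not> H v k\<rbrakk> \<Longrightarrow> False"
    and no_K4: "\<lbrakk>{a, b, c, d, p, q} \<subseteq> V; H a b; H a c; H a d; H b c; H b d; H c d; H a p; H b q;
      \<not> H p b; \<not> H p c; \<not> H p d; \<not> H q a; \<not> H q c; \<not> H q d; \<not> H p q\<rbrakk> \<Longrightarrow> False"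
begin

section \<open>Anticomplete stars and the vertices attached to them\<close>

lemma sym_iff: "H x y \<longleftrightarrow> H y x"
  using sym by blast

text \<open>Vertices other than the centre \<open>u\<close> may be adjacent to each other, so this
  is a graph with a dominating vertex rather than a star in the usual sense. The required edge lets
  each side supply one of the edges of \<open>no_3K2\<close>.\<close>

definition star :: "'a set \<Rightarrow> 'a \<Rightarrow> bool" where
  "star C u \<longleftrightarrow> C \<subseteq> V \<and> u \<in> C \<and> (\<exists>x\<in>C. H u x) \<and> (\<forall>x\<in>C. x \<noteq> u \<longrightarrow> H u x)"

lemma starD:
  assumes "star C u"
  shows "x \<in> C \<Longrightarrow> x \<in> V" "u \<in> C" "\<exists>x\<in>C. H u x" "x \<in> C \<Longrightarrow> x \<noteq> u \<Longrightarrow> H u x"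
  using assms by (auto simp: star_def)

text \<open>If \<open>v\<close> misses the centre, its neighbour \<open>x\<close> becomes the new
  centre: a vertex \<open>y\<close> missed by \<open>x\<close> would turn \<open>v\<close>,
  \<open>x\<close>, \<open>u\<close>, \<open>y\<close> into a 4-cycle or an induced path, the latter
  forbidden together with the isolated \<open>c\<close>.\<close>

lemma star_extend:
  assumes st: "star C u" and c: "c \<in> V" "\<And>x. x \<in> C \<Longrightarrow> \<not> H x c"
    and v: "v \<in> V" "v \<notin> C" "\<not> H v c" and x: "x \<in> C" "H v x"
  shows "\<exists>u'. star (insert v C) u'"
proof -
  note s = starD[OF st]
  have x_dom: "H x y" if vu: "\<not> H v u" and y: "y \<in> C" "y \<noteq> x" for y
  proof (rule ccontr)
    assume n: "\<not> H x y"
    have xu: "x \<noteq> u" using x vu by blast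
    have yu: "y \<noteq> u" using n xu x s(4) sym by blast
    have "v \<noteq> u" "v \<noteq> y" using v s(2) y by blast+
    then show False
      using no_C4[of v x u y] no_cogem[of y u x v c] s(1,2) s(4)[of x] s(4)[of y] x y n vu xu yu c v sym_iff
      by (cases "H v y") auto
  qed
  show ?thesis
  proof (cases "H v u")
    case True
    then have "star (insert v C) u" using st v sym by (auto simp: star_def)
    then show ?thesis by blast
  next
    case False
    then have "star (insert v C) x" using st v x sym x_dom[OF False] by (auto simp: star_def)
    then show ?thesis by blast
  qed
qed

text \<open>The centre \<open>u\<close> can serve as one of the two vertices, being adjacent to all
  others.\<close>

lemma star_boundary:
  assumes st: "star C u" and x: "x \<in> C" "H k x" and y: "y \<in> C" "\<not> H k y"
  shows "\<exists>x\<in>C. \<exists>y\<in>C. H k x \<and> \<not> H k y \<and> H x y"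
proof (cases "H k u")
  case True
  then have "H u y" using starD(4)[OF st, of y] y by blast
  then show ?thesis using True y starD(2)[OF st] by blast
next
  case False
  then have "H x u" using starD(4)[OF st, of x] x sym by blast
  then show ?thesis using False x starD(2)[OF st] by blast
qed

text \<open>Otherwise each side has an edge with just one end adjacent to \<open>k\<close>, and the
  two edges form an induced path on five vertices with midpoint \<open>k\<close>.\<close>

lemma complete_to_one_star:
  assumes st: "star C u" "star C' u'" and anti: "\<And>x y. \<lbrakk>x \<in> C; y \<in> C'\<rbrakk> \<Longrightarrow> \<not> H x y"
    and k: "k \<in> V" "x \<in> C" "H k x" "x' \<in> C'" "H k x'"
  shows "(\<forall>y\<in>C. H k y) \<or> (\<forall>y\<in>C'. H k y)"
proof (rule ccontr)
  have anti': "\<not> H y x" if "x \<in> C" "y \<in> C'" for x y using anti that sym by blast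
  assume "\<not> ?thesis"
  then obtain y y' where "y \<in> C" "\<not> H k y" "y' \<in> C'" "\<not> H k y'" by blast
  then obtain x y x' y' where *: "x \<in> C" "y \<in> C" "H k x" "\<not> H k y" "H x y"
    "x' \<in> C'" "y' \<in> C'" "H k x'" "\<not> H k y'" "H x' y'"
    using star_boundary[OF st(1) k(2,3)] star_boundary[OF st(2) k(4,5)] by meson
  then show False
    using no_P5[of y x k x' y'] starD(1)[OF st(1)] starD(1)[OF st(2)] k anti anti' sym_iff by auto
qed

text \<open>Nonadjacent \<open>k\<close> and \<open>l\<close> are linked through \<open>C\<close> by
  a path with one, two or three inner vertices; each length leads to a 4-cycle, a 5-cycle or an
  induced path on five vertices.\<close>

lemma attachments_adjacent:
  assumes st: "star C u" "star C' u'" and anti: "\<And>x y. \<lbrakk>x \<in> C; y \<in> C'\<rbrakk> \<Longrightarrow> \<not> H x y"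
    and dj: "C \<inter> C' = {}"
    and k: "k \<in> V" "k \<notin> C" "x \<in> C" "H k x" "z \<in> C'" "H k z"
    and l: "l \<in> V" "l \<notin> C" "x' \<in> C" "H l x'" "z' \<in> C'" "H l z'"
    and kl: "k \<noteq> l"
  shows "H k l"
proof (rule ccontr)
  assume n: "\<not> H k l"
  have V: "y \<in> V" if "y \<in> C \<union> C'" for y using that starD(1)[OF st(1)] starD(1)[OF st(2)] by blast
  have anti': "\<not> H y x" if "x \<in> C" "y \<in> C'" for x y using anti that sym by blast
  \<comment> \<open>A common neighbour in \<open>C'\<close> too would close a 4-cycle, so
    \<open>k\<close> and \<open>l\<close> have private neighbours \<open>z\<close>,
    \<open>z'\<close> there; these prolong \<open>k\<close>, \<open>m\<close>, \<open>l\<close> to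
    an induced path or a 5-cycle.\<close>
  have common: "\<not> (H k m \<and> H l m)" if m: "m \<in> C" for m
  proof
    assume kl_m: "H k m \<and> H l m"
    have none: "\<not> (H k r \<and> H l r)" if "r \<in> C'" for r
      using no_C4[of k m l r] kl_m m that V k l n kl anti dj sym_iff by auto
    then have "\<not> H l z" "\<not> H k z'" using k l by blast+
    then show False
      using no_P5[of z k m l z'] no_C5[of z k m l z'] kl_m m V k l n anti anti' sym_iff
      by (cases "H z z'") auto
  qed
  have common': "\<not> (H k m \<and> H l m)" if m: "m \<in> C'" for m
  proof
    assume kl_m: "H k m \<and> H l m"
    have "\<not> H l x" "\<not> H k x'" using common k l by blast+
    then show False
      using no_P5[of x k m l x'] no_C5[of x k m l x'] kl_m m V k l n anti anti' sym_iff
      by (cases "H x x'") auto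
  qed
  have no_edge: False if h: "y \<in> C" "y' \<in> C" "H k y" "H l y'" "H y y'" for y y'
  proof -
    have "\<not> H l y" "\<not> H k y'" "\<not> H l z" "\<not> H k z'" using common common' h k l by blast+
    then show False
      using no_P5[of z k y y' l] h V k l n anti anti' sym_iff by auto
  qed
  have xx: "\<not> H x x'" using no_edge k l by blast
  have "x \<noteq> x'" using common k l by blast
  have xu: "x \<noteq> u" "x' \<noteq> u" using xx starD(4)[OF st(1)] k l \<open>x \<noteq> x'\<close> sym by blast+
  have ux: "H u x" "H u x'" using starD(4)[OF st(1)] k l xu by blast+
  \<comment> \<open>The centre is adjacent to \<open>x\<close> and \<open>x'\<close>, hence by
    \<open>no_edge\<close> to neither \<open>k\<close> nor \<open>l\<close>, and the path
    \<open>k\<close>, \<open>x\<close>, \<open>u\<close>, \<open>x'\<close>, \<open>l\<close> is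
    induced.\<close>
  have "\<not> H k u" "\<not> H l u" using no_edge[of u x'] no_edge[of x u] ux k l starD(2)[OF st(1)] sym by blast+
  moreover have "\<not> H l x" "\<not> H k x'" using common k l by blast+
  ultimately show False
    using no_P5[of k x u x' l] xx ux V k l n starD(2)[OF st(1)] sym_iff by auto
qed

text \<open>The split partition with a maximum clique \<open>A\<close> satisfies everything but possibly \<open>closed_W\<close>.
  If that fails at \<open>a \<in> A\<close>, then \<open>a\<close> is the only vertex of \<open>A\<close> without neighbours in \<open>W\<close>, and moving
  it to \<open>W\<close> repairs the failure.\<close>

lemma side_partition_exists:
  assumes st: "star C u" and c: "c \<in> V" "\<And>x. x \<in> C \<Longrightarrow> \<not> H x c"
    and no_2K2: "\<And>a b c d. \<lbrakk>a \<in> C; b \<in> C; c \<in> C; d \<in> C; H a b; H c d;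
      \<not> H a c; \<not> H a d; \<not> H b c; \<not> H b d\<rbrakk> \<Longrightarrow> False"
    and K: "K \<subseteq> V" "K \<inter> C = {}" "\<And>k l. \<lbrakk>k \<in> K; l \<in> K; k \<noteq> l\<rbrakk> \<Longrightarrow> H k l" "\<And>k. k \<in> K \<Longrightarrow> H k c"
  shows "\<exists>A W. side_partition H C K A W"
proof -
  have CV: "x \<in> V" if "x \<in> C" for x using starD(1)[OF st] that .
  have KV: "k \<in> V" "k \<notin> C" if "k \<in> K" for k using K that by auto
  have uC: "u \<in> C" using starD(2)[OF st] .
  have c': "\<not> H c x" if "x \<in> C" for x using c that sym by blast
  have Kc: "H k c" "H c k" if "k \<in> K" for k using K(4) that sym by blast+
  \<comment> \<open>Let \<open>x\<close>, \<open>y\<close> be private to \<open>k\<close>,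
    \<open>l\<close>. If adjacent, they close a 4-cycle. Otherwise both are adjacent to the centre
    \<open>u\<close>, whose adjacency to \<open>k\<close> and \<open>l\<close> decides between a
    3-sun with third tip \<open>c\<close>, a 4-cycle and a 5-cycle.\<close>
  have nested_K: "H k y \<or> H l x" if h: "k \<in> K" "l \<in> K" "x \<in> C" "y \<in> C" "H k x" "H l y" for k l x y
  proof (rule ccontr)
    assume n: "\<not> ?thesis"
    have kl: "H k l" "k \<noteq> l" using h n K by blast+
    have xy: "x \<noteq> y" using h n by blast
    have kny: "k \<noteq> y" "l \<noteq> x" using h KV by blast+
    show False
    proof (cases "H x y")
      case True
      then show False using no_C4[of k x y l] h n CV KV kl xy kny sym_iff by auto
    next
      case False
      have xu: "x \<noteq> u" "y \<noteq> u" using False h xy starD(4)[OF st] sym by blast+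
      then have ux: "H u x" "H u y" using starD(4)[OF st] h by blast+
      have ku: "k \<noteq> u" "l \<noteq> u" using KV uC h by blast+
      consider "H u k" "H u l" | "H u k" "\<not> H u l" | "\<not> H u k" "H u l" | "\<not> H u k" "\<not> H u l" by blast
      then show False
      proof cases
        case 1
        then show False
          using no_sun[of u k l x y c] h n False kl ux Kc[of k] Kc[of l] c c' CV KV uC sym_iff by auto
      next
        case 2
        then show False
          using no_C4[of u k l y] h n kl ux ku kny CV KV uC sym_iff by auto
      next
        case 3
        then show False
          using no_C4[of u l k x] h n kl ux ku kny CV KV uC sym_iff by auto
      next
        case 4
        then show False
          using no_C5[of u x k l y] h n kl ux False CV KV uC sym_iff by auto
      qed
    qed
  qed
  have "\<exists>A\<subseteq>C. (\<forall>x\<in>A. \<forall>y\<in>A. x \<noteq> y \<longrightarrow> H x y) \<and> (\<forall>x\<in>C - A. \<forall>y\<in>C - A. \<not> H x y) \<and>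
    (\<forall>x\<in>C - A. \<exists>y\<in>A. \<not> H x y)"
  proof (rule split_graph_partition)
    show "finite C" using fin CV by (meson finite_subset subsetI)
    show False if "a \<in> C" "b \<in> C" "c \<in> C" "d \<in> C" "H a b" "H b c" "H c d" "H d a"
      "\<not> H a c" "\<not> H b d" "a \<noteq> c" "b \<noteq> d" for a b c d
      using that no_C4[of a b c d] CV by simp
    show False if "a \<in> C" "b \<in> C" "c \<in> C" "d \<in> C" "e \<in> C" "H a b" "H b c" "H c d" "H d e" "H e a"
      "\<not> H a c" "\<not> H a d" "\<not> H b d" "\<not> H b e" "\<not> H c e" for a b c d e
      using that no_C5[of a b c d e] CV by simp
  qed (fact sym irr no_2K2)+
  then obtain A where AC: "A \<subseteq> C" and A: "\<forall>x\<in>A. \<forall>y\<in>A. x \<noteq> y \<longrightarrow> H x y"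
    "\<forall>x\<in>C - A. \<forall>y\<in>C - A. \<not> H x y" "\<forall>x\<in>C - A. \<exists>y\<in>A. \<not> H x y"
    by blast
  define W where "W = C - A"
  have Acl: "H x y" if "x \<in> A" "y \<in> A" "x \<noteq> y" for x y using A(1) that by blast
  have Wind: "\<not> H x y" if "x \<in> W" "y \<in> W" for x y using A(2) that W_def by blast
  have nonnbr: "\<exists>y\<in>A. \<not> H x y" if "x \<in> W" for x using A(3) that W_def by blast
  have AC': "x \<in> C" if "x \<in> A" for x using AC that by blast
  have WC: "x \<in> C" "x \<notin> A" if "x \<in> W" for x using that by (auto simp: W_def)
  \<comment> \<open>Every vertex outside \<open>A\<close> misses a vertex of \<open>A\<close>,
    whereas the centre misses none.\<close>
  have uA: "u \<in> A"
  proof (rule ccontr)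
    assume "u \<notin> A"
    then show False using nonnbr[of u] starD(4)[OF st] uC AC' by (auto simp: W_def)
  qed
  have wu: "H w u" "H u w" if "w \<in> W" for w
    using starD(4)[OF st, of w] that WC uA sym by blast+
  have nest: "H a w' \<or> H a' w" if h: "a \<in> A" "a' \<in> A" "w \<in> W" "w' \<in> W" "H a w" "H a' w'" for a a' w w'
  proof (rule ccontr)
    assume n: "\<not> ?thesis"
    then have "a \<noteq> a'" using h by blast
    then show False
      using no_cogem[of w a a' w' c] h n Acl[of a a'] Wind[of w w'] c c' CV WC AC' sym_iff by auto
  qed
  \<comment> \<open>If \<open>H k v\<close>, then \<open>k\<close>, \<open>x\<close>,
    \<open>a\<close>, \<open>v\<close> is a 4-cycle; otherwise \<open>v\<close>, \<open>a\<close>,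
    \<open>x\<close>, \<open>k\<close>, \<open>c\<close> is an induced path.\<close>
  have crossing: False if h: "k \<in> K" "a \<in> A" "x \<in> C" "v \<in> C" "x \<noteq> v" "H k x" "H a x" "\<not> H k a"
    "H a v" "\<not> H x v" for k a x v
  proof -
    have "k \<noteq> a" using h KV AC' by blast
    then show False
      using no_C4[of k x a v] no_P5[of v a x k c] h Kc[of k] c c' CV KV AC' sym_iff
      by (cases "H k v") auto
  qed
  have closed_A: "H k a" if h: "k \<in> K" "w \<in> W" "a \<in> A" "H k w" "H a w" for k w a
  proof (rule ccontr)
    assume n: "\<not> ?thesis"
    obtain a' where a': "a' \<in> A" "\<not> H w a'" using nonnbr h by blast
    then have "a \<noteq> a'" using h sym by blast
    then show False using crossing[of k a w a'] h n a' Acl[of a a'] WC AC' by blast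
  qed
  \<comment> \<open>From here on \<open>k\<close>, \<open>w\<close>, \<open>a\<close> violate
    \<open>closed_W\<close>. If \<open>k\<close> missed the centre, \<open>w\<close>,
    \<open>u\<close>, \<open>a\<close>, \<open>k\<close>, \<open>c\<close> would be an induced
    path.\<close>
  have ku: "H k u" if h: "k \<in> K" "w \<in> W" "a \<in> A" "H k a" "\<not> H a w" "\<not> H k w" for k w a
  proof (rule ccontr)
    assume n: "\<not> H k u"
    have au: "a \<noteq> u" using h wu by blast
    then show False using no_P5[of w u a k c] n h wu Acl[of a u] uA Kc[of k] c c' CV KV WC AC' sym_iff by auto
  qed
  \<comment> \<open>A neighbour \<open>v\<close> of \<open>a\<close> in \<open>W\<close> gives, if
    \<open>H k v\<close>, a 4-clique \<open>u\<close>, \<open>k\<close>, \<open>a\<close>,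
    \<open>v\<close> with pendants \<open>w\<close> and \<open>c\<close>; otherwise the path
    \<open>v\<close>, \<open>a\<close>, \<open>k\<close>, \<open>c\<close> with \<open>w\<close>
    isolated.\<close>
  have no_W_nbr: "\<not> H a v" if h: "k \<in> K" "w \<in> W" "a \<in> A" "H k a" "\<not> H a w" "\<not> H k w" "v \<in> W" for k w a v
  proof
    assume av: "H a v"
    have au: "a \<noteq> u" using h wu by blast
    have "H k u" using ku h by blast
    then show False
      using no_K4[of u k a v w c] no_cogem[of v a k c w] h av wu Acl[of a u] au uA Kc[of k] c c' CV KV WC AC'
        Wind[of v w] sym_iff by (cases "H k v") auto
  qed
  show ?thesis
  proof (cases "\<exists>k\<in>K. \<exists>w\<in>W. \<exists>a\<in>A. H k a \<and> \<not> H a w \<and> \<not> H k w")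
    case False
    have "side_partition H C K A W"
    proof
      show "C = A \<union> W" using AC by (auto simp: W_def)
      show "A \<inter> W = {}" by (auto simp: W_def)
      show "H a w \<or> H k w" if "k \<in> K" "w \<in> W" "a \<in> A" "H k a" for k w a
        using False that by blast
    qed (fact Acl Wind nest closed_A nested_K)+
    then show ?thesis by blast
  next
    case True
    then obtain k w a where kwa: "k \<in> K" "w \<in> W" "a \<in> A" "H k a" "\<not> H a w" "\<not> H k w" by blast
    have aW: "\<not> H a v" "\<not> H v a" if "v \<in> W" for v using no_W_nbr kwa that sym by blast+
    have ku': "H k u" using ku kwa by blast
    have au: "a \<noteq> u" using kwa wu by blast
    \<comment> \<open>The same two patterns as in \<open>no_W_nbr\<close>, with \<open>b\<close>,
      adjacent to \<open>a\<close> within the clique, in place of \<open>v\<close>.\<close>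
    have other: "\<exists>v\<in>W. H b v" if b: "b \<in> A" "b \<noteq> a" for b
    proof (rule ccontr)
      assume "\<not> ?thesis"
      then have nb: "\<not> H b w" using kwa by blast
      then have bu: "b \<noteq> u" using kwa wu by blast
      show False
        using no_K4[of u k a b w c] no_cogem[of b a k c w] kwa b bu nb wu Acl[of a u] Acl[of b u] Acl[of a b]
          au ku' uA Kc[of k] c c' CV KV WC AC' sym_iff by (cases "H k b") auto
    qed
    have "side_partition H C K (A - {a}) (insert a W)"
    proof
      show "C = (A - {a}) \<union> insert a W" using AC kwa by (auto simp: W_def)
      show "(A - {a}) \<inter> insert a W = {}" by (auto simp: W_def)
      show "H x y" if "x \<in> A - {a}" "y \<in> A - {a}" "x \<noteq> y" for x y using Acl that by blast
      show "\<not> H x y" if "x \<in> insert a W" "y \<in> insert a W" for x y using Wind aW irr that by auto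
      show "H b v' \<or> H b' v" if "b \<in> A - {a}" "b' \<in> A - {a}" "v \<in> insert a W" "v' \<in> insert a W"
        "H b v" "H b' v'" for b b' v v'
        using that nest[of b b' v v'] Acl kwa by auto
      show "H l b" if h: "l \<in> K" "v \<in> insert a W" "b \<in> A - {a}" "H l v" "H b v" for l v b
      proof (cases "v = a")
        case True
        obtain v' where v': "v' \<in> W" "H b v'" using other h by blast
        show ?thesis
        proof (rule ccontr)
          assume n: "\<not> H l b"
          \<comment> \<open>The moved vertex \<open>a\<close> is adjacent to \<open>l\<close> and
            \<open>b\<close> but not to \<open>v'\<close>, which is the situation excluded by
            \<open>crossing\<close>.\<close>
          show False using crossing[of l b a v'] h n v' True aW kwa AC' WC by blast
        qed
      next
        case False
        then show ?thesis using closed_A[of l v b] h by blast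
      qed
      show "H b v \<or> H l v" if h: "l \<in> K" "v \<in> insert a W" "b \<in> A - {a}" "H l b" for l v b
      proof (cases "v = a")
        case True
        then show ?thesis using Acl[of b a] h kwa by blast
      next
        case False
        then have v: "v \<in> W" using h by blast
        obtain v' where v': "v' \<in> W" "H b v'" using other h by blast
        \<comment> \<open>A failure at \<open>b\<close> would leave it without neighbours in
          \<open>W\<close>, against \<open>v'\<close>.\<close>
        show ?thesis using no_W_nbr[of l v b v'] v v' h by blast
      qed
    qed (fact nested_K)
    then show ?thesis by blast
  qed
qed

section \<open>Assembling the partition from two maximal anticomplete stars\<close>

text \<open>The partition is one for the complement of \<open>H\<close>, in which \<open>a\<close>,
  \<open>c\<close>, \<open>b\<close>, \<open>d\<close> is an induced 4-cycle and, by
  \<open>no_univ\<close>, no vertex is isolated. The latter keeps attached vertices from being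
  complete to both stars.\<close>

lemma special_partition_2K2:
  assumes abcd: "{a, b, c, d} \<subseteq> V" "H a b" "H c d" "\<not> H a c" "\<not> H a d" "\<not> H b c" "\<not> H b d"
    and no_univ: "\<And>x. x \<in> V \<Longrightarrow> \<exists>y\<in>V. y \<noteq> x \<and> \<not> H x y"
  shows "\<exists>A D W. V = A \<union> D \<union> W \<and> special_partition (\<lambda>x y. x \<noteq> y \<and> \<not> H x y) A D W"
proof -
  define S where "S = {(C, C'). (\<exists>u. star C u) \<and> (\<exists>u. star C' u) \<and> C \<inter> C' = {} \<and> (\<forall>x\<in>C. \<forall>y\<in>C'. \<not> H x y)}"
  have "S \<subseteq> Pow V \<times> Pow V" by (auto simp: S_def star_def)
  then have "finite S" using fin by (simp add: finite_subset)
  moreover have "({a, b}, {c, d}) \<in> S"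
  proof -
    have "star {a, b} a" "star {c, d} c" using abcd by (auto simp: star_def)
    then show ?thesis using abcd sym by (auto simp: S_def)
  qed
  ultimately have "\<exists>p\<in>S. \<forall>q\<in>S. card (fst q) + card (snd q) \<le> card (fst p) + card (snd p)"
    by (intro finite_has_max_image) auto
  then obtain p where p: "p \<in> S" "\<forall>q\<in>S. card (fst q) + card (snd q) \<le> card (fst p) + card (snd p)" by blast
  define C C' where "C = fst p" and "C' = snd p"
  have CC: "(C, C') \<in> S" using p(1) by (simp add: C_def C'_def)
  have maxC: "card B + card B' \<le> card C + card C'" if "(B, B') \<in> S" for B B'
    using p(2) that by (fastforce simp: C_def C'_def)
  obtain u u' where st: "star C u" and st': "star C' u'" and dj: "C \<inter> C' = {}"
    and anti: "\<And>x y. \<lbrakk>x \<in> C; y \<in> C'\<rbrakk> \<Longrightarrow> \<not> H x y"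
    using CC by (auto simp: S_def)
  have anti': "\<not> H y x" if "x \<in> C" "y \<in> C'" for x y using anti that sym by blast
  have CV: "x \<in> V" if "x \<in> C" for x using starD(1)[OF st] that .
  have CV': "x \<in> V" if "x \<in> C'" for x using starD(1)[OF st'] that .
  have uC: "u \<in> C" "u' \<in> C'" using starD(2)[OF st] starD(2)[OF st'] by auto
  have finC: "finite C" "finite C'"
    using CV CV' fin by (meson finite_subset subsetI)+
  obtain t t' where t: "t \<in> C" "H u t" "t' \<in> C'" "H u' t'" using starD(3)[OF st] starD(3)[OF st'] by blast
  \<comment> \<open>A vertex with a neighbour in \<open>C\<close> but none in \<open>C'\<close>
    could be added to \<open>C\<close> by \<open>star_extend\<close>, with the centre
    \<open>u'\<close> as the vertex missed by everything, against maximality.\<close>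
  have ext: "\<exists>y\<in>C'. H v y" if v: "v \<in> V" "v \<notin> C" "v \<notin> C'" "x \<in> C" "H v x" for v x
  proof (rule ccontr)
    assume n: "\<not> ?thesis"
    have "\<exists>w. star (insert v C) w"
      using star_extend[OF st, of u' v x] n v uC CV' anti by blast
    then have "(insert v C, C') \<in> S" using CC n v by (auto simp: S_def)
    then show False using maxC[of "insert v C" C'] v finC by simp
  qed
  have ext': "\<exists>y\<in>C. H v y" if v: "v \<in> V" "v \<notin> C" "v \<notin> C'" "x \<in> C'" "H v x" for v x
  proof (rule ccontr)
    assume n: "\<not> ?thesis"
    have "\<exists>w. star (insert v C') w"
      using star_extend[OF st', of u v x] n v uC CV anti' by blast
    then have "(C, insert v C') \<in> S" using CC n v sym by (auto simp: S_def)
    then show False using maxC[of C "insert v C'"] v finC by simp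
  qed
  define K where "K = {v \<in> V - C - C'. \<exists>x\<in>C. H v x}"
  define I where "I = {v \<in> V - C - C'. \<forall>x\<in>C. \<not> H v x}"
  have KV: "k \<in> V" "k \<notin> C" "k \<notin> C'" "\<exists>x\<in>C. H k x" "\<exists>x\<in>C'. H k x" if "k \<in> K" for k
    using that ext by (auto simp: K_def)
  have IV: "i \<in> V" "i \<notin> C" "i \<notin> C'" if "i \<in> I" for i using that by (auto simp: I_def)
  have IC: "\<not> H i x" "\<not> H x i" if "i \<in> I" "x \<in> C" for i x
    using that sym by (auto simp: I_def)
  have IC': "\<not> H i x" "\<not> H x i" if "i \<in> I" "x \<in> C'" for i x
    using that sym ext'[of i x] by (auto simp: I_def)
  have Kcl: "H k l" if kl: "k \<in> K" "l \<in> K" "k \<noteq> l" for k l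
  proof -
    obtain x z x' z' where "x \<in> C" "H k x" "z \<in> C'" "H k z" "x' \<in> C" "H l x'" "z' \<in> C'" "H l z'"
      using KV(4,5)[OF kl(1)] KV(4,5)[OF kl(2)] by blast
    then show ?thesis
      using attachments_adjacent[OF st st' anti dj] KV kl by blast
  qed
  have one: "(\<forall>y\<in>C. H k y) \<or> (\<forall>y\<in>C'. H k y)" if k: "k \<in> K" for k
  proof -
    obtain x z where "x \<in> C" "H k x" "z \<in> C'" "H k z" using KV(4,5)[OF k] by blast
    then show ?thesis using complete_to_one_star[OF st st' anti] KV(1)[OF k] by blast
  qed
  \<comment> \<open>An edge inside \<open>I\<close> would be a third one, anticomplete to an edge of
    each star.\<close>
  have II: "\<not> H i p" if "i \<in> I" "p \<in> I" for i p
    using no_3K2[of i p u t u' t'] that t uC IV CV CV' IC IC' anti by auto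
  \<comment> \<open>A non-neighbour of \<open>k\<close> in one star gives an induced path on four
    vertices through \<open>k\<close> with \<open>i\<close> isolated. If \<open>k\<close> is
    complete to both stars, it is the centre of a butterfly with \<open>i\<close> isolated.\<close>
  have KI: "H k i" if k: "k \<in> K" and I: "i \<in> I" for k i
  proof (rule ccontr)
    assume n: "\<not> H k i"
    obtain x z where xz: "x \<in> C" "H k x" "z \<in> C'" "H k z" using KV(4,5)[OF k] by blast
    consider y where "y \<in> C" "\<not> H k y" | y where "y \<in> C'" "\<not> H k y"
      | "\<forall>y\<in>C. H k y" "\<forall>y\<in>C'. H k y" by blast
    then show False
    proof cases
      case 1
      then obtain x y where "x \<in> C" "y \<in> C" "H k x" "\<not> H k y" "H x y"
        using star_boundary[OF st xz(1,2)] by blast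
      then show False
        using no_cogem[of y x k z i] xz n k I KV(1) IV CV CV' IC IC' anti anti' sym_iff by auto
    next
      case 2
      then obtain z y where "z \<in> C'" "y \<in> C'" "H k z" "\<not> H k y" "H z y"
        using star_boundary[OF st' xz(3,4)] by blast
      then show False
        using no_cogem[of y z k x i] xz n k I KV(1) IV CV CV' IC IC' anti anti' sym_iff by auto
    next
      case 3
      then have "H k u" "H k t" "H k u'" "H k t'" using t uC by blast+
      moreover have "\<not> H i k" using n sym by blast
      ultimately show False
        using no_butterfly[of u t u' t' k i] t uC k I KV(1) IV CV CV' IC IC' anti by auto
    qed
  qed
  have V_eq: "V = C \<union> C' \<union> K \<union> I" using CV CV' by (auto simp: K_def I_def)
  \<comment> \<open>Such a vertex would be universal, being adjacent to \<open>I\<close> and to the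
    rest of \<open>K\<close> as well.\<close>
  have not_both: "\<not> ((\<forall>y\<in>C. H k y) \<and> (\<forall>y\<in>C'. H k y))" if k: "k \<in> K" for k
    using no_univ[OF KV(1)[OF k]] V_eq KI[OF k] Kcl[OF k] by blast
  \<comment> \<open>The index names the star in which the vertex has non-neighbours; there it takes
    part in a \<open>side_partition\<close>.\<close>
  define K1 where "K1 = {k \<in> K. \<forall>y\<in>C'. H k y}"
  define K2 where "K2 = {k \<in> K. \<forall>y\<in>C. H k y}"
  have K12: "K = K1 \<union> K2" "K1 \<inter> K2 = {}" using one not_both unfolding K1_def K2_def by blast+
  have K1: "k \<in> K" "y \<in> C' \<Longrightarrow> H k y" "y \<in> C' \<Longrightarrow> H y k" if "k \<in> K1" for k y
    using that sym by (auto simp: K1_def)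
  have K2: "k \<in> K" "y \<in> C \<Longrightarrow> H k y" "y \<in> C \<Longrightarrow> H y k" if "k \<in> K2" for k y
    using that sym by (auto simp: K2_def)
  have "\<exists>A W. side_partition H C K1 A W"
  proof (rule side_partition_exists[OF st, of u'])
    \<comment> \<open>The edge of the other star would be the third of three anticomplete
      edges.\<close>
    show False if "a \<in> C" "b \<in> C" "c \<in> C" "d \<in> C" "H a b" "H c d"
      "\<not> H a c" "\<not> H a d" "\<not> H b c" "\<not> H b d" for a b c d
      using no_3K2[of a b c d u' t'] that t uC CV CV' anti by simp
    show "u' \<in> V" using CV' uC by blast
    show "\<not> H x u'" if "x \<in> C" for x using anti that uC by blast
    show "K1 \<subseteq> V" "K1 \<inter> C = {}" using K1(1) KV by blast+
    show "H k l" if "k \<in> K1" "l \<in> K1" "k \<noteq> l" for k l using Kcl K1(1) that by blast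
    show "H k u'" if "k \<in> K1" for k using K1(2) that uC by blast
  qed
  then obtain A1 W1 where "side_partition H C K1 A1 W1" by blast
  then interpret s1: side_partition H C K1 A1 W1 .
  have "\<exists>A W. side_partition H C' K2 A W"
  proof (rule side_partition_exists[OF st', of u])
    show False if "a \<in> C'" "b \<in> C'" "c \<in> C'" "d \<in> C'" "H a b" "H c d"
      "\<not> H a c" "\<not> H a d" "\<not> H b c" "\<not> H b d" for a b c d
      using no_3K2[of a b c d u t] that t uC CV CV' anti' by simp
    show "u \<in> V" using CV uC by blast
    show "\<not> H x u" if "x \<in> C'" for x using anti' that uC by blast
    show "K2 \<subseteq> V" "K2 \<inter> C' = {}" using K2(1) KV by blast+
    show "H k l" if "k \<in> K2" "l \<in> K2" "k \<noteq> l" for k l using Kcl K2(1) that by blast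
    show "H k u" if "k \<in> K2" for k using K2(2) that uC by blast
  qed
  then obtain A2 W2 where "side_partition H C' K2 A2 W2" by blast
  then interpret s2: side_partition H C' K2 A2 W2 .
  have AC: "x \<in> C" if "x \<in> A1 \<or> x \<in> W1" for x using that s1.C_eq by blast
  have AC': "x \<in> C'" if "x \<in> A2 \<or> x \<in> W2" for x using that s2.C_eq by blast
  \<comment> \<open>The exchange: \<open>K2\<close> is complete to \<open>C\<close>, hence to
    \<open>A1\<close>, so \<open>A\<close> is a clique of \<open>H\<close>; likewise
    \<open>D\<close>, since \<open>K1\<close> is complete to \<open>C'\<close>.\<close>
  define A where "A = A1 \<union> K2"
  define D where "D = A2 \<union> K1"
  define W where "W = W1 \<union> W2 \<union> I"
  have sets: "A1 \<subseteq> C" "W1 \<subseteq> C" "A2 \<subseteq> C'" "W2 \<subseteq> C'" "K1 \<subseteq> K" "K2 \<subseteq> K"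
    using s1.C_eq s2.C_eq K12(1) by auto
  have dj': "K \<inter> C = {}" "K \<inter> C' = {}" "I \<inter> C = {}" "I \<inter> C' = {}" "K \<inter> I = {}"
    by (auto simp: K_def I_def)
  have dis: "A \<inter> D = {}"
    unfolding A_def D_def using sets dj' dj K12(2) by blast
  have dis': "A \<inter> W = {}"
    unfolding A_def W_def using sets dj' dj s1.disj by blast
  have dis'': "D \<inter> W = {}"
    unfolding D_def W_def using sets dj' dj s2.disj by blast
  have Acl: "H x y" if "x \<in> A" "y \<in> A" "x \<noteq> y" for x y
    using that s1.clique_A Kcl K2 AC unfolding A_def by blast
  have Dcl: "H x y" if "x \<in> D" "y \<in> D" "x \<noteq> y" for x y
    using that s2.clique_A Kcl K1 AC' unfolding D_def by blast
  have Wind: "\<not> H x y" if "x \<in> W" "y \<in> W" for x y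
    using that s1.indep_W s2.indep_W II IC IC' anti anti' AC AC' unfolding W_def by blast
  \<comment> \<open>Within \<open>W\<close>, vertices of \<open>K2\<close> miss only members of
    \<open>W2\<close> and vertices of \<open>A1\<close> meet only members of \<open>W1\<close>, and
    symmetrically. The conditions linking \<open>W\<close> to \<open>A\<close> and \<open>D\<close>
    are thus settled on one side at a time.\<close>
  have K2W: "w \<in> W2" if "k \<in> K2" "w \<in> W" "\<not> H k w" for k w
    using that K2 KI AC unfolding W_def by blast
  have K1W: "w \<in> W1" if "k \<in> K1" "w \<in> W" "\<not> H k w" for k w
    using that K1 KI AC' unfolding W_def by blast
  have A1W: "w \<in> W1" if "x \<in> A1" "w \<in> W" "H x w" for x w
    using that anti IC AC AC' unfolding W_def by blast
  have A2W: "w \<in> W2" if "x \<in> A2" "w \<in> W" "H x w" for x w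
    using that anti' IC' AC AC' unfolding W_def by blast
  have c1: "\<not> H a d" if h: "a \<in> A" "d \<in> D" "w \<in> W" "\<not> H a w" "\<not> H d w" for a d w
  proof
    assume ad: "H a d"
    consider "a \<in> A1" "d \<in> A2" | "a \<in> A1" "d \<in> K1" | "a \<in> K2" "d \<in> A2" | "a \<in> K2" "d \<in> K1"
      using h unfolding A_def D_def by blast
    then show False
    proof cases
      case 1 then show False using ad anti AC AC' by blast
    next
      case 2 then show False using s1.closed_W[of d w a] K1W[of d w] ad h sym by blast
    next
      case 3 then show False using s2.closed_W[of a w d] K2W[of a w] ad h by blast
    next
      case 4 then show False using K1W[of d w] K2W[of a w] h AC AC' dj by blast
    qed
  qed
  have c2: "H a d" if h: "a \<in> A" "d \<in> D" "w \<in> W" "H a w" "H d w" for a d w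
  proof -
    consider "a \<in> A1" "d \<in> A2" | "a \<in> A1" "d \<in> K1" | "a \<in> K2" "d \<in> A2" | "a \<in> K2" "d \<in> K1"
      using h unfolding A_def D_def by blast
    then show ?thesis
    proof cases
      case 1 then show ?thesis using A1W[of a w] A2W[of d w] h AC AC' dj by blast
    next
      case 2 then show ?thesis using s1.closed_A[of d w a] A1W[of a w] h sym by blast
    next
      case 3 then show ?thesis using s2.closed_A[of a w d] A2W[of d w] h by blast
    next
      case 4 then show ?thesis using Kcl K1(1) K2(1) K12(2) by blast
    qed
  qed
  have n1: "H a w \<or> H a' w'" if h: "a \<in> A" "a' \<in> A" "w \<in> W" "w' \<in> W" "H a w'" "H a' w" for a a' w w'
  proof (rule ccontr)
    assume n: "\<not> ?thesis"
    consider "a \<in> A1" "a' \<in> A1" | "a \<in> A1" "a' \<in> K2" | "a \<in> K2" "a' \<in> A1" | "a \<in> K2" "a' \<in> K2"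
      using h unfolding A_def by blast
    then show False
    proof cases
      case 1 then show False using s1.nested_AW[of a a' w' w] A1W[of a w'] A1W[of a' w] h n by blast
    next
      case 2 then show False using A1W[of a w'] K2W[of a' w'] h n AC AC' dj by blast
    next
      case 3 then show False using A1W[of a' w] K2W[of a w] h n AC AC' dj by blast
    next
      case 4 then show False using s2.nested_K[of a a' w' w] K2W[of a w] K2W[of a' w'] h n AC' by blast
    qed
  qed
  have n2: "H a w \<or> H a' w'" if h: "a \<in> D" "a' \<in> D" "w \<in> W" "w' \<in> W" "H a w'" "H a' w" for a a' w w'
  proof (rule ccontr)
    assume n: "\<not> ?thesis"
    consider "a \<in> A2" "a' \<in> A2" | "a \<in> A2" "a' \<in> K1" | "a \<in> K1" "a' \<in> A2" | "a \<in> K1" "a' \<in> K1"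
      using h unfolding D_def by blast
    then show False
    proof cases
      case 1 then show False using s2.nested_AW[of a a' w' w] A2W[of a w'] A2W[of a' w] h n by blast
    next
      case 2 then show False using A2W[of a w'] K1W[of a' w'] h n AC AC' dj by blast
    next
      case 3 then show False using A2W[of a' w] K1W[of a w] h n AC AC' dj by blast
    next
      case 4 then show False using s1.nested_K[of a a' w' w] K1W[of a w] K1W[of a' w'] h n AC by blast
    qed
  qed
  have ADV: "x \<in> V" if "x \<in> A \<or> x \<in> D" for x
    using that AC AC' CV CV' KV(1) K1(1) K2(1) unfolding A_def D_def by blast
  \<comment> \<open>Both \<open>A\<close> and \<open>D\<close> are cliques of \<open>H\<close>, so a
    failure would be an induced 4-cycle.\<close>
  have n3: "H a d \<or> H a' d'" if h: "a \<in> A" "a' \<in> A" "d \<in> D" "d' \<in> D" "H a d'" "H a' d" for a a' d d'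
  proof (rule ccontr)
    assume n: "\<not> ?thesis"
    then have ne: "a \<noteq> a'" "d \<noteq> d'" using h by blast+
    have "a \<noteq> d" "a' \<noteq> d'" using h dis by blast+
    then show False
      using no_C4[of a d' d a'] h n ne Acl[of a a'] Dcl[of d d'] ADV sym_iff by auto
  qed
  have "special_partition (\<lambda>x y. x \<noteq> y \<and> \<not> H x y) A D W"
  proof
    show "A \<inter> D = {}" "A \<inter> W = {}" "D \<inter> W = {}" by (fact dis dis' dis'')+
    show "\<not> (x \<noteq> y \<and> \<not> H x y)" if "x \<in> A" "y \<in> A" for x y using Acl that by blast
    show "\<not> (x \<noteq> y \<and> \<not> H x y)" if "x \<in> D" "y \<in> D" for x y using Dcl that by blast
    show "x \<noteq> y \<and> \<not> H x y" if "x \<in> W" "y \<in> W" "x \<noteq> y" for x y using Wind that by blast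
    show "a \<noteq> d \<and> \<not> H a d" if "a \<in> A" "d \<in> D" "w \<in> W" "a \<noteq> w \<and> \<not> H a w" "d \<noteq> w \<and> \<not> H d w" for a d w
      using c1 that dis dis' dis'' by blast
    show "(a \<noteq> w \<and> \<not> H a w) \<or> (d \<noteq> w \<and> \<not> H d w)" if "a \<in> A" "d \<in> D" "w \<in> W" "a \<noteq> d \<and> \<not> H a d" for a d w
      using c2[of a d w] that dis dis' dis'' by blast
    show "(a \<noteq> w' \<and> \<not> H a w') \<or> (a' \<noteq> w \<and> \<not> H a' w)" if "a \<in> A" "a' \<in> A" "w \<in> W" "w' \<in> W"
      "a \<noteq> w \<and> \<not> H a w" "a' \<noteq> w' \<and> \<not> H a' w'" for a a' w w'
      using n1[of a a' w w'] that dis dis' dis'' by blast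
    show "(a \<noteq> w' \<and> \<not> H a w') \<or> (a' \<noteq> w \<and> \<not> H a' w)" if "a \<in> D" "a' \<in> D" "w \<in> W" "w' \<in> W"
      "a \<noteq> w \<and> \<not> H a w" "a' \<noteq> w' \<and> \<not> H a' w'" for a a' w w'
      using n2[of a a' w w'] that dis dis' dis'' by blast
    show "(a \<noteq> w' \<and> \<not> H a w') \<or> (a' \<noteq> w \<and> \<not> H a' w)" if "a \<in> A" "a' \<in> A" "w \<in> D" "w' \<in> D"
      "a \<noteq> w \<and> \<not> H a w" "a' \<noteq> w' \<and> \<not> H a' w'" for a a' w w'
      using n3[of a a' w w'] that dis dis' dis'' by blast
  qed
  moreover have "V = A \<union> D \<union> W"
    using V_eq K12(1) s1.C_eq s2.C_eq unfolding A_def D_def W_def by blast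
  ultimately show ?thesis by blast
qed

end

section \<open>Excluded graphs of a special graph\<close>

text \<open>\<open>wh\<close> marks the white vertices and \<open>ot\<close> those with
  \<open>Otimes White\<close>. Only the later of two vertices is asked for its operator, so the
  value at the first vertex never matters. With integer positions every pattern becomes a question
  of linear arithmetic.\<close>

locale special_order =
  fixes E :: "'a \<Rightarrow> 'a \<Rightarrow> bool" and V :: "'a set" and pos :: "'a \<Rightarrow> int" and wh ot :: "'a \<Rightarrow> bool"
  assumes sym: "E x y \<Longrightarrow> E y x" and irr: "\<not> E x x" and inj: "inj_on pos V"
    and edge: "\<lbrakk>x \<in> V; y \<in> V; pos x < pos y\<rbrakk> \<Longrightarrow> E x y \<longleftrightarrow> wh x \<and> ot y"
begin

lemma adj:
  assumes "x \<in> V" "y \<in> V" "E x y"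
  shows "(pos x < pos y \<and> wh x \<and> ot y) \<or> (pos y < pos x \<and> wh y \<and> ot x)"
proof -
  have "pos x \<noteq> pos y" using assms inj irr by (auto dest: inj_onD)
  then consider "pos x < pos y" | "pos y < pos x" by linarith
  then show ?thesis using edge[of x y] edge[of y x] assms sym[of x y] by cases simp_all
qed

lemma nonadj:
  assumes "x \<in> V" "y \<in> V" "x \<noteq> y" "\<not> E x y"
  shows "pos x \<noteq> pos y \<and> \<not> ((pos x < pos y \<and> wh x \<and> ot y) \<or> (pos y < pos x \<and> wh y \<and> ot x))"
  using edge[of x y] edge[of y x] assms sym[of y x] inj_onD[OF inj, of x y] by auto

text \<open>Each edge has a white earlier end and a later end satisfying \<open>ot\<close>. The last
  of the four vertices is such a later end, hence adjacent to the earlier end of the other edge. The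
  remaining patterns are refuted in the same way, by exhausting the possible orders.\<close>

lemma no_2K2:
  assumes "{a, b, c, d} \<subseteq> V" "E a b" "E c d" "\<not> E a c" "\<not> E a d" "\<not> E b c"
    "\<not> E b d"
  shows False
proof -
  have V: "a \<in> V" "b \<in> V" "c \<in> V" "d \<in> V" using assms(1) by auto
  have ne: "a \<noteq> c" "a \<noteq> d" "b \<noteq> c" "b \<noteq> d"
    using assms sym irr by blast+
  show False
    using adj[OF V(1) V(2) assms(2)] adj[OF V(3) V(4) assms(3)] nonadj[OF V(1) V(3) ne(1) assms(4)]
      nonadj[OF V(1) V(4) ne(2) assms(5)] nonadj[OF V(2) V(3) ne(3) assms(6)] nonadj[OF V(2) V(4) ne(4) assms(7)]
    by (smt (verit))
qed

lemma no_C5: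
  assumes "{a, b, c, d, e} \<subseteq> V" "E a b" "E b c" "E c d" "E d e" "E e a" "\<not> E a c"
    "\<not> E a d" "\<not> E b d" "\<not> E b e" "\<not> E c e"
  shows False
proof -
  have V: "a \<in> V" "b \<in> V" "c \<in> V" "d \<in> V" "e \<in> V" using assms(1) by auto
  have ne: "a \<noteq> c" "a \<noteq> d" "b \<noteq> d" "b \<noteq> e" "c \<noteq> e"
    using assms sym irr by blast+
  show False
    using adj[OF V(1) V(2) assms(2)] adj[OF V(2) V(3) assms(3)] adj[OF V(3) V(4) assms(4)]
      adj[OF V(4) V(5) assms(5)] adj[OF V(5) V(1) assms(6)] nonadj[OF V(1) V(3) ne(1) assms(7)]
      nonadj[OF V(1) V(4) ne(2) assms(8)] nonadj[OF V(2) V(4) ne(3) assms(9)] nonadj[OF V(2) V(5) ne(4) assms(10)]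
      nonadj[OF V(3) V(5) ne(5) assms(11)]
    by (smt (verit))
qed

lemma no_net:
  assumes "{a, b, c, x, y, z} \<subseteq> V" "E a b" "E b c" "E a c" "E a x" "E b y" "E c z"
    "\<not> E a y" "\<not> E a z" "\<not> E b x" "\<not> E b z" "\<not> E c x" "\<not> E c y"
    "\<not> E x y" "\<not> E x z" "\<not> E y z"
  shows False
proof -
  have V: "a \<in> V" "b \<in> V" "c \<in> V" "x \<in> V" "y \<in> V" "z \<in> V" using assms(1) by auto
  have ne: "a \<noteq> y" "a \<noteq> z" "b \<noteq> x" "b \<noteq> z" "c \<noteq> x" "c \<noteq> y"
    "x \<noteq> y" "x \<noteq> z" "y \<noteq> z"
    using assms sym irr by blast+
  show False
    using adj[OF V(1) V(2) assms(2)] adj[OF V(2) V(3) assms(3)] adj[OF V(1) V(3) assms(4)]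
      adj[OF V(1) V(4) assms(5)] adj[OF V(2) V(5) assms(6)] adj[OF V(3) V(6) assms(7)]
      nonadj[OF V(1) V(5) ne(1) assms(8)] nonadj[OF V(1) V(6) ne(2) assms(9)] nonadj[OF V(2) V(4) ne(3) assms(10)]
      nonadj[OF V(2) V(6) ne(4) assms(11)] nonadj[OF V(3) V(4) ne(5) assms(12)] nonadj[OF V(3) V(5) ne(6) assms(13)]
      nonadj[OF V(4) V(5) ne(7) assms(14)] nonadj[OF V(4) V(6) ne(8) assms(15)] nonadj[OF V(5) V(6) ne(9) assms(16)]
    by (smt (verit))
qed

lemma no_house:
  assumes "{a, b, c, d, e} \<subseteq> V" "E a b" "E b c" "E c d" "E d a" "E e a" "E e b" "\<not> E a c"
    "\<not> E b d" "\<not> E e c" "\<not> E e d"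
  shows False
proof -
  have V: "a \<in> V" "b \<in> V" "c \<in> V" "d \<in> V" "e \<in> V" using assms(1) by auto
  have ne: "a \<noteq> c" "b \<noteq> d" "e \<noteq> c" "e \<noteq> d"
    using assms sym irr by blast+
  show False
    using adj[OF V(1) V(2) assms(2)] adj[OF V(2) V(3) assms(3)] adj[OF V(3) V(4) assms(4)]
      adj[OF V(4) V(1) assms(5)] adj[OF V(5) V(1) assms(6)] adj[OF V(5) V(2) assms(7)]
      nonadj[OF V(1) V(3) ne(1) assms(8)] nonadj[OF V(2) V(4) ne(2) assms(9)] nonadj[OF V(5) V(3) ne(3) assms(10)]
      nonadj[OF V(5) V(4) ne(4) assms(11)]
    by (smt (verit))
qed

lemma no_gem:
  assumes "{a, b, c, d, e} \<subseteq> V" "E a b" "E b c" "E c d" "E e a" "E e b" "E e c" "E e d"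
    "\<not> E a c" "\<not> E a d" "\<not> E b d"
  shows False
proof -
  have V: "a \<in> V" "b \<in> V" "c \<in> V" "d \<in> V" "e \<in> V" using assms(1) by auto
  have ne: "a \<noteq> c" "a \<noteq> d" "b \<noteq> d"
    using assms sym irr by blast+
  show False
    using adj[OF V(1) V(2) assms(2)] adj[OF V(2) V(3) assms(3)] adj[OF V(3) V(4) assms(4)]
      adj[OF V(5) V(1) assms(5)] adj[OF V(5) V(2) assms(6)] adj[OF V(5) V(3) assms(7)]
      adj[OF V(5) V(4) assms(8)] nonadj[OF V(1) V(3) ne(1) assms(9)] nonadj[OF V(1) V(4) ne(2) assms(10)]
      nonadj[OF V(2) V(4) ne(3) assms(11)]
    by (smt (verit))
qed

lemma no_octahedron:
  assumes "{a, a', b, b', c, c'} \<subseteq> V" "a \<noteq> a'" "b \<noteq> b'" "c \<noteq> c'" "E a b"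
    "E a b'" "E a c" "E a c'" "E a' b" "E a' b'" "E a' c" "E a' c'" "E b c" "E b c'" "E b' c" "E b' c'"
    "\<not> E a a'" "\<not> E b b'" "\<not> E c c'"
  shows False
proof -
  have V: "a \<in> V" "a' \<in> V" "b \<in> V" "b' \<in> V" "c \<in> V" "c' \<in> V" using assms(1) by auto
  have ne: "a \<noteq> a'" "b \<noteq> b'" "c \<noteq> c'"
    using assms sym irr by blast+
  show False
    using adj[OF V(1) V(3) assms(5)] adj[OF V(1) V(4) assms(6)] adj[OF V(1) V(5) assms(7)]
      adj[OF V(1) V(6) assms(8)] adj[OF V(2) V(3) assms(9)] adj[OF V(2) V(4) assms(10)]
      adj[OF V(2) V(5) assms(11)] adj[OF V(2) V(6) assms(12)] adj[OF V(3) V(5) assms(13)]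
      adj[OF V(3) V(6) assms(14)] adj[OF V(4) V(5) assms(15)] adj[OF V(4) V(6) assms(16)]
      nonadj[OF V(1) V(2) ne(1) assms(17)] nonadj[OF V(3) V(4) ne(2) assms(18)] nonadj[OF V(5) V(6) ne(3) assms(19)]
    by (smt (verit))
qed

lemma no_wheel:
  assumes "{a, b, c, d, e, p} \<subseteq> V" "a \<noteq> c" "b \<noteq> d" "E a b" "E b c" "E c d" "E d a"
    "E e a" "E e b" "E e c" "E e d" "E e p" "\<not> E a c" "\<not> E b d" "\<not> E a p" "\<not> E b p"
    "\<not> E c p" "\<not> E d p"
  shows False
proof -
  have V: "a \<in> V" "b \<in> V" "c \<in> V" "d \<in> V" "e \<in> V" "p \<in> V" using assms(1) by auto
  have ne: "a \<noteq> c" "b \<noteq> d" "a \<noteq> p" "b \<noteq> p" "c \<noteq> p" "d \<noteq> p"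
    using assms sym irr by blast+
  show False
    using adj[OF V(1) V(2) assms(4)] adj[OF V(2) V(3) assms(5)] adj[OF V(3) V(4) assms(6)]
      adj[OF V(4) V(1) assms(7)] adj[OF V(5) V(1) assms(8)] adj[OF V(5) V(2) assms(9)]
      adj[OF V(5) V(3) assms(10)] adj[OF V(5) V(4) assms(11)] adj[OF V(5) V(6) assms(12)]
      nonadj[OF V(1) V(3) ne(1) assms(13)] nonadj[OF V(2) V(4) ne(2) assms(14)] nonadj[OF V(1) V(6) ne(3) assms(15)]
      nonadj[OF V(2) V(6) ne(4) assms(16)] nonadj[OF V(3) V(6) ne(5) assms(17)] nonadj[OF V(4) V(6) ne(6) assms(18)]
    by (smt (verit))
qed

lemma no_diamond:
  assumes "{a, b, c, d, p, q} \<subseteq> V" "c \<noteq> d" "E a b" "E a c" "E a d" "E b c" "E b d"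
    "E a p" "E b q" "\<not> E c d" "\<not> E a q" "\<not> E b p" "\<not> E c p" "\<not> E c q"
    "\<not> E d p" "\<not> E d q" "\<not> E p q"
  shows False
proof -
  have V: "a \<in> V" "b \<in> V" "c \<in> V" "d \<in> V" "p \<in> V" "q \<in> V" using assms(1) by auto
  have ne: "c \<noteq> d" "a \<noteq> q" "b \<noteq> p" "c \<noteq> p" "c \<noteq> q" "d \<noteq> p"
    "d \<noteq> q" "p \<noteq> q"
    using assms sym irr by blast+
  show False
    using adj[OF V(1) V(2) assms(3)] adj[OF V(1) V(3) assms(4)] adj[OF V(1) V(4) assms(5)]
      adj[OF V(2) V(3) assms(6)] adj[OF V(2) V(4) assms(7)] adj[OF V(1) V(5) assms(8)]
      adj[OF V(2) V(6) assms(9)] nonadj[OF V(3) V(4) ne(1) assms(10)] nonadj[OF V(1) V(6) ne(2) assms(11)]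
      nonadj[OF V(2) V(5) ne(3) assms(12)] nonadj[OF V(3) V(5) ne(4) assms(13)] nonadj[OF V(3) V(6) ne(5) assms(14)]
      nonadj[OF V(4) V(5) ne(6) assms(15)] nonadj[OF V(4) V(6) ne(7) assms(16)] nonadj[OF V(5) V(6) ne(8) assms(17)]
    by (smt (verit))
qed

lemma special_free_of_order:
  assumes "finite V"
  shows "special_free E V"
  by (unfold_locales) (fact assms sym irr no_2K2 no_C5 no_net no_house no_gem no_octahedron no_wheel no_diamond)+

end

section \<open>Vertex subsets, complements, and the passage to digraphs\<close>

text \<open>Forbidden patterns are hereditary; this permits discarding isolated vertices.\<close>

lemma special_free_subset:
  assumes "special_free E V" "U \<subseteq> V"
  shows "special_free E U"
proof -
  interpret special_free E V by fact
  have "finite U" using fin assms(2) by (rule rev_finite_subset)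
  then show ?thesis
    by (rule special_free.intro)
      (fact sym irr no_2K2[OF subset_trans[OF _ assms(2)]]
        no_C5[OF subset_trans[OF _ assms(2)]]
        no_net[OF subset_trans[OF _ assms(2)]]
        no_house[OF subset_trans[OF _ assms(2)]]
        no_gem[OF subset_trans[OF _ assms(2)]]
        no_octahedron[OF subset_trans[OF _ assms(2)]]
        no_wheel[OF subset_trans[OF _ assms(2)]]
        no_diamond[OF subset_trans[OF _ assms(2)]])+
qed

text \<open>The permuted arguments encode the complementation: the 5-cycle is traversed in steps of
  two, the tips of the sun form the triangle of the net, and the pendants of the 4-clique become the
  degree-three vertices of the diamond. As \<open>\<not> ?H x y\<close> also allows
  \<open>x = y\<close>, distinctness is derived first, except for the 4-cycle.\<close>

lemma (in special_free) co_special_free: "co_special_free (\<lambda>x y. x \<noteq> y \<and> \<not> E x y) V"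
proof
  let ?H = "\<lambda>x y. x \<noteq> y \<and> \<not> E x y"
  show "finite V" by (fact fin)
  show "?H y x" if "?H x y" for x y using that sym by blast
  show "\<not> ?H x x" for x by simp
  show False if "{a, b, c, d} \<subseteq> V" "?H a b" "?H b c" "?H c d" "?H d a" "\<not> ?H a c"
      "\<not> ?H b d" "a \<noteq> c" "b \<noteq> d"
    for a b c d
    using that no_2K2[of a c b d] sym_iff by auto
  show False if "{a, b, c, d, e} \<subseteq> V" "?H a b" "?H b c" "?H c d" "?H d e" "?H e a"
      "\<not> ?H a c" "\<not> ?H a d" "\<not> ?H b d" "\<not> ?H b e" "\<not> ?H c e" for a b c d e
  proof -
    have "distinct [a, b, c, d, e]" using that sym by auto
    then show False using that no_C5[of a c e b d] sym_iff by auto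
  qed
  show False if "{a, b, c, d, e} \<subseteq> V" "?H a b" "?H b c" "?H c d" "?H d e"
      "\<not> ?H a c" "\<not> ?H a d" "\<not> ?H a e" "\<not> ?H b d" "\<not> ?H b e"
      "\<not> ?H c e" for a b c d e
  proof -
    have "distinct [a, b, c, d, e]" using that sym by auto
    then show False using that no_house[of a e b d c] sym_iff by auto
  qed
  show False if "{u, k, l, x, y, z} \<subseteq> V" "?H u k" "?H u l" "?H k l" "?H x u" "?H x k" "?H y u"
      "?H y l"
      "?H z k" "?H z l" "\<not> ?H x l" "\<not> ?H y k" "\<not> ?H z u" "\<not> ?H x y" "\<not> ?H x z"
      "\<not> ?H y z" for u k l x y z
  proof -
    have "distinct [u, k, l, x, y, z]" using that sym by auto
    then show False using that no_net[of z y x u k l] sym_iff by auto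
  qed
  show False if "{a, b, c, d, v} \<subseteq> V" "?H a b" "?H b c" "?H c d" "\<not> ?H a c" "\<not> ?H a d"
      "\<not> ?H b d"
      "\<not> ?H a v" "\<not> ?H b v" "\<not> ?H c v" "\<not> ?H d v" for a b c d v
  proof -
    have "distinct [a, b, c, d, v]" using that sym by auto
    then show False using that no_gem[of b d a c v] sym_iff by auto
  qed
  show False if "{a, a', b, b', c, c'} \<subseteq> V" "?H a a'" "?H b b'" "?H c c'" "\<not> ?H a b"
      "\<not> ?H a b'" "\<not> ?H a c"
      "\<not> ?H a c'" "\<not> ?H a' b" "\<not> ?H a' b'" "\<not> ?H a' c" "\<not> ?H a' c'"
      "\<not> ?H b c" "\<not> ?H b c'"
      "\<not> ?H b' c" "\<not> ?H b' c'" for a a' b b' c c'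
  proof -
    have "distinct [a, a', b, b', c, c']" using that sym by auto
    then show False using that no_octahedron[of a a' b b' c c'] by auto
  qed
  show False if "{a, b, c, d, k, v} \<subseteq> V" "?H a b" "?H c d" "?H k a" "?H k b" "?H k c" "?H k d"
      "\<not> ?H a c" "\<not> ?H a d" "\<not> ?H b c" "\<not> ?H b d" "\<not> ?H v a" "\<not> ?H v b"
      "\<not> ?H v c" "\<not> ?H v d" "\<not> ?H v k"
    for a b c d k v
  proof -
    have "distinct [a, b, c, d, k, v]" using that sym by auto
    then show False using that no_wheel[of a c b d v k] sym_iff by auto
  qed
  show False if "{a, b, c, d, p, q} \<subseteq> V" "?H a b" "?H a c" "?H a d" "?H b c" "?H b d" "?H c d"
      "?H a p" "?H b q"
      "\<not> ?H p b" "\<not> ?H p c" "\<not> ?H p d" "\<not> ?H q a" "\<not> ?H q c" "\<not> ?H q d"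
      "\<not> ?H p q" for a b c d p q
  proof -
    have "distinct [a, b, c, d, p, q]" using that sym by auto
    then show False using that no_diamond[of q p c d a b] sym_iff by auto
  qed
qed

lemma special_imp_special_free:
  fixes G :: "('a, 'b) pre_digraph"
  assumes "graph G" "special_two_threshold G"
  shows "special_free (\<lambda>x y. x \<rightarrow>\<^bsub>G\<^esub> y) (verts G)"
proof -
  interpret graph G by fact
  obtain vs col oper where dec: "decomposition G vs col oper"
    and ops: "\<And>j. 1 \<le> j \<Longrightarrow> j < length vs \<Longrightarrow> oper (vs ! j) \<in> {Oplus, Otimes White}"
    using assms(2) unfolding special_two_threshold_def by blast
  have vs: "distinct vs" "set vs = verts G" using dec by (auto simp: decomposition_def)
  define idx where "idx = the_inv_into {..<length vs} ((!) vs)"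
  have bij: "bij_betw ((!) vs) {..<length vs} (verts G)" using vs by (auto intro: bij_betw_nth)
  have idx: "idx x < length vs" "vs ! idx x = x" if "x \<in> verts G" for x
    using that bij unfolding idx_def bij_betw_def
    by (auto simp: f_the_inv_into_f dest: the_inv_into_into[of _ _ _ "{..<length vs}"])
  \<comment> \<open>Since \<open>i < j\<close>, the index \<open>j\<close> is positive, so the
    restriction on operators applies to \<open>vs ! j\<close>.\<close>
  have nth: "vs ! j \<rightarrow>\<^bsub>G\<^esub> vs ! i \<longleftrightarrow> col (vs ! i) = White \<and> oper (vs ! j) = Otimes White"
    if "i < j" "j < length vs" for i j
  proof -
    have "case oper (vs ! j) of Oplus \<Rightarrow> \<forall>i<j. \<not> vs ! j \<rightarrow>\<^bsub>G\<^esub> vs ! i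
         | Otimes c \<Rightarrow> \<forall>i<j. vs ! j \<rightarrow>\<^bsub>G\<^esub> vs ! i \<longleftrightarrow> col (vs ! i) = c"
      using dec that by (auto simp: decomposition_def)
    moreover have "oper (vs ! j) \<in> {Oplus, Otimes White}" using ops[of j] that by simp
    ultimately show ?thesis using that by auto
  qed
  interpret special_order "\<lambda>x y. x \<rightarrow>\<^bsub>G\<^esub> y" "verts G" "\<lambda>x. int (idx x)"
    "\<lambda>x. col x = White" "\<lambda>x. oper x = Otimes White"
  proof
    show sy: "y \<rightarrow>\<^bsub>G\<^esub> x" if "x \<rightarrow>\<^bsub>G\<^esub> y" for x y using that sym_arcs by (auto dest: arcs_ends_symmetric)
    show "\<not> x \<rightarrow>\<^bsub>G\<^esub> x" for x using adj_not_same by blast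
    show "inj_on (\<lambda>x. int (idx x)) (verts G)"
    proof (rule inj_onI)
      fix x y assume xy: "x \<in> verts G" "y \<in> verts G" and "int (idx x) = int (idx y)"
      then have "vs ! idx x = vs ! idx y" by simp
      then show "x = y" using idx(2) xy by simp
    qed
    show "x \<rightarrow>\<^bsub>G\<^esub> y \<longleftrightarrow> col x = White \<and> oper y = Otimes White"
      if "x \<in> verts G" "y \<in> verts G" "int (idx x) < int (idx y)" for x y
    proof -
      have "y \<rightarrow>\<^bsub>G\<^esub> x \<longleftrightarrow> col x = White \<and> oper y = Otimes White"
        using nth[of "idx x" "idx y"] idx[OF that(1)] idx[OF that(2)] that(3) by simp
      then show ?thesis using sy by blast
    qed
  qed
  show ?thesis by (rule special_free_of_order) simp
qed

lemma special_free_imp_no_induced: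
  fixes G :: "('a, 'b) pre_digraph"
  assumes "graph G" and sf: "special_free (\<lambda>x y. x \<rightarrow>\<^bsub>G\<^esub> y) (verts G)"
  shows "\<not> has_induced G two_K2" "\<not> has_induced G C5" "\<not> has_induced G net"
      "\<not> has_induced G house"
    "\<not> has_induced G gem" "\<not> has_induced G octahedron" "\<not> has_induced G wheel4_pendant"
    "\<not> has_induced G diamond_two_pendants"
proof -
  interpret special_free "\<lambda>x y. x \<rightarrow>\<^bsub>G\<^esub> y" "verts G" by fact
  have none: "\<not> has_induced G (graph_of_edges n F)"
    if "\<And>f. \<lbrakk>\<And>i. i < n \<Longrightarrow> f i \<in> verts G; \<And>i j. \<lbrakk>i < n; j < n; i \<noteq> j\<rbrakk> \<Longrightarrow> f i \<noteq> f j;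
      \<And>i j. \<lbrakk>i < n; j < n\<rbrakk> \<Longrightarrow> f i \<rightarrow>\<^bsub>G\<^esub> f j \<longleftrightarrow> (i, j) \<in> F \<union> F\<inverse>\<rbrakk> \<Longrightarrow> False" for n F
  proof
    assume "has_induced G (graph_of_edges n F)"
    then obtain f where "induced_copy (verts G) (\<lambda>x y. x \<rightarrow>\<^bsub>G\<^esub> y) n F f"
      using has_induced_imp_copy \<open>graph G\<close> by blast
    then show False by (intro that[of f]) (auto simp: induced_copy_def dest: inj_onD)
  qed
  show "\<not> has_induced G two_K2" unfolding two_K2_def
    by (rule none, rule_tac a = "f 0" and b = "f 1" and c = "f 2" and d = "f 3" in no_2K2) auto
  show "\<not> has_induced G C5" unfolding C5_def
    by (rule none, rule_tac a = "f 0" and b = "f 1" and c = "f 2" and d = "f 3" and e = "f 4" in no_C5) auto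
  show "\<not> has_induced G net" unfolding net_def
    by (rule none, rule_tac a = "f 0" and b = "f 1" and c = "f 2" and x = "f 3" and y = "f 4" and z = "f 5" in no_net) auto
  show "\<not> has_induced G house" unfolding house_def
    by (rule none, rule_tac a = "f 0" and b = "f 1" and c = "f 2" and d = "f 3" and e = "f 4" in no_house) auto
  show "\<not> has_induced G gem" unfolding gem_def
    by (rule none, rule_tac a = "f 0" and b = "f 1" and c = "f 2" and d = "f 3" and e = "f 4" in no_gem) auto
  show "\<not> has_induced G octahedron" unfolding octahedron_def
    by (rule none, rule_tac a = "f 0" and a' = "f 1" and b = "f 2" and b' = "f 3" and c = "f 4" and c' = "f 5"
        in no_octahedron) auto
  show "\<not> has_induced G wheel4_pendant" unfolding wheel4_pendant_def
    by (rule none, rule_tac a = "f 0" and b = "f 1" and c = "f 2" and d = "f 3" and e = "f 4" and p = "f 5"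
        in no_wheel) auto
  show "\<not> has_induced G diamond_two_pendants" unfolding diamond_two_pendants_def
    by (rule none, rule_tac a = "f 0" and b = "f 1" and c = "f 2" and d = "f 3" and p = "f 4" and q = "f 5"
        in no_diamond) auto
qed

lemma no_induced_imp_special_free:
  fixes G :: "('a, 'b) pre_digraph"
  assumes "graph G"
    and no: "\<not> has_induced G two_K2" "\<not> has_induced G C5" "\<not> has_induced G net"
      "\<not> has_induced G house"
    "\<not> has_induced G gem" "\<not> has_induced G octahedron" "\<not> has_induced G wheel4_pendant"
    "\<not> has_induced G diamond_two_pendants"
  shows "special_free (\<lambda>x y. x \<rightarrow>\<^bsub>G\<^esub> y) (verts G)"
proof -
  interpret graph G by fact
  have sy: "x \<rightarrow>\<^bsub>G\<^esub> y \<longleftrightarrow> y \<rightarrow>\<^bsub>G\<^esub> x" for x y using sym_arcs by (auto dest: arcs_ends_symmetric)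
  have ir: "\<not> x \<rightarrow>\<^bsub>G\<^esub> x" for x using adj_not_same by blast
  have copy: "has_induced G (graph_of_edges (length xs) F)"
    if "set xs \<subseteq> verts G" "distinct xs" "F \<subseteq> {..<length xs} \<times> {..<length xs}"
      "\<forall>i<length xs. \<forall>j<length xs. xs ! i \<rightarrow>\<^bsub>G\<^esub> xs ! j \<longleftrightarrow> (i, j) \<in> F \<union> F\<inverse>" for xs F
  proof (rule copy_imp_has_induced[OF \<open>graph G\<close> that(3), of "(!) xs"])
    show "induced_copy (verts G) (\<lambda>x y. x \<rightarrow>\<^bsub>G\<^esub> y) (length xs) F ((!) xs)"
      unfolding induced_copy_def
    proof (intro conjI)
      show "inj_on ((!) xs) {..<length xs}" using that(2) by (simp add: inj_on_nth)
      show "(!) xs ` {..<length xs} \<subseteq> verts G" using that(1) nth_mem by blast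
    qed (fact that(4))
  qed
  \<comment> \<open>Unfolds the quantifiers over indices into finitely many adjacency facts, each
    supplied by \<open>h\<close>, \<open>rev\<close> or irreflexivity.\<close>
  note small = All_less_Suc numeral_eq_Suc ir
  show ?thesis
  proof
    show "y \<rightarrow>\<^bsub>G\<^esub> x" if "x \<rightarrow>\<^bsub>G\<^esub> y" for x y using that sy by blast
    show "\<not> x \<rightarrow>\<^bsub>G\<^esub> x" for x by (fact ir)
  next
    fix a b c d assume h: "{a, b, c, d} \<subseteq> verts G" "a \<rightarrow>\<^bsub>G\<^esub> b"
      "c \<rightarrow>\<^bsub>G\<^esub> d" "\<not> a \<rightarrow>\<^bsub>G\<^esub> c"
      "\<not> a \<rightarrow>\<^bsub>G\<^esub> d" "\<not> b \<rightarrow>\<^bsub>G\<^esub> c"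
      "\<not> b \<rightarrow>\<^bsub>G\<^esub> d"
    have ne: "a \<noteq> c" "a \<noteq> d" "b \<noteq> c" "b \<noteq> d" using h sy ir by blast+
    have rev: "b \<rightarrow>\<^bsub>G\<^esub> a" "d \<rightarrow>\<^bsub>G\<^esub> c"
      "\<not> c \<rightarrow>\<^bsub>G\<^esub> a" "\<not> d \<rightarrow>\<^bsub>G\<^esub> a"
      "\<not> c \<rightarrow>\<^bsub>G\<^esub> b"
      "\<not> d \<rightarrow>\<^bsub>G\<^esub> b" using h sy by blast+
    have "distinct [a, b, c, d]" using ne h ir by auto
    then have "has_induced G two_K2"
      using copy[of "[a, b, c, d]" "{(0,1), (2,3)}"] h rev unfolding two_K2_def by (simp add: small)
    then show False using no by blast
  next
    fix a b c d e assume h: "{a, b, c, d, e} \<subseteq> verts G" "a \<rightarrow>\<^bsub>G\<^esub> b"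
      "b \<rightarrow>\<^bsub>G\<^esub> c" "c \<rightarrow>\<^bsub>G\<^esub> d"
      "d \<rightarrow>\<^bsub>G\<^esub> e" "e \<rightarrow>\<^bsub>G\<^esub> a"
      "\<not> a \<rightarrow>\<^bsub>G\<^esub> c" "\<not> a \<rightarrow>\<^bsub>G\<^esub> d"
      "\<not> b \<rightarrow>\<^bsub>G\<^esub> d" "\<not> b \<rightarrow>\<^bsub>G\<^esub> e"
      "\<not> c \<rightarrow>\<^bsub>G\<^esub> e"
    have ne: "a \<noteq> c" "a \<noteq> d" "b \<noteq> d" "b \<noteq> e" "c \<noteq> e" using h sy ir by blast+
    have rev: "b \<rightarrow>\<^bsub>G\<^esub> a" "c \<rightarrow>\<^bsub>G\<^esub> b"
      "d \<rightarrow>\<^bsub>G\<^esub> c" "e \<rightarrow>\<^bsub>G\<^esub> d"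
      "a \<rightarrow>\<^bsub>G\<^esub> e" "\<not> c \<rightarrow>\<^bsub>G\<^esub> a"
      "\<not> d \<rightarrow>\<^bsub>G\<^esub> a" "\<not> d \<rightarrow>\<^bsub>G\<^esub> b"
      "\<not> e \<rightarrow>\<^bsub>G\<^esub> b"
      "\<not> e \<rightarrow>\<^bsub>G\<^esub> c" using h sy by blast+
    have "distinct [a, b, c, d, e]" using ne h ir by auto
    then have "has_induced G C5"
      using copy[of "[a, b, c, d, e]"
      "{(0,1), (1,2), (2,3), (3,4), (4,0)}"] h rev unfolding C5_def by (simp add: small)
    then show False using no by blast
  next
    fix a b c x y z assume h: "{a, b, c, x, y, z} \<subseteq> verts G"
      "a \<rightarrow>\<^bsub>G\<^esub> b" "b \<rightarrow>\<^bsub>G\<^esub> c"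
      "a \<rightarrow>\<^bsub>G\<^esub> c" "a \<rightarrow>\<^bsub>G\<^esub> x"
      "b \<rightarrow>\<^bsub>G\<^esub> y" "c \<rightarrow>\<^bsub>G\<^esub> z"
      "\<not> a \<rightarrow>\<^bsub>G\<^esub> y" "\<not> a \<rightarrow>\<^bsub>G\<^esub> z"
      "\<not> b \<rightarrow>\<^bsub>G\<^esub> x" "\<not> b \<rightarrow>\<^bsub>G\<^esub> z"
      "\<not> c \<rightarrow>\<^bsub>G\<^esub> x" "\<not> c \<rightarrow>\<^bsub>G\<^esub> y"
      "\<not> x \<rightarrow>\<^bsub>G\<^esub> y" "\<not> x \<rightarrow>\<^bsub>G\<^esub> z"
      "\<not> y \<rightarrow>\<^bsub>G\<^esub> z"
    have ne: "a \<noteq> y" "a \<noteq> z" "b \<noteq> x" "b \<noteq> z" "c \<noteq> x" "c \<noteq> y"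
      "x \<noteq> y" "x \<noteq> z" "y \<noteq> z" using h sy ir by blast+
    have rev: "b \<rightarrow>\<^bsub>G\<^esub> a" "c \<rightarrow>\<^bsub>G\<^esub> b"
      "c \<rightarrow>\<^bsub>G\<^esub> a" "x \<rightarrow>\<^bsub>G\<^esub> a"
      "y \<rightarrow>\<^bsub>G\<^esub> b" "z \<rightarrow>\<^bsub>G\<^esub> c"
      "\<not> y \<rightarrow>\<^bsub>G\<^esub> a" "\<not> z \<rightarrow>\<^bsub>G\<^esub> a"
      "\<not> x \<rightarrow>\<^bsub>G\<^esub> b" "\<not> z \<rightarrow>\<^bsub>G\<^esub> b"
      "\<not> x \<rightarrow>\<^bsub>G\<^esub> c" "\<not> y \<rightarrow>\<^bsub>G\<^esub> c"
      "\<not> y \<rightarrow>\<^bsub>G\<^esub> x" "\<not> z \<rightarrow>\<^bsub>G\<^esub> x"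
      "\<not> z \<rightarrow>\<^bsub>G\<^esub> y" using h sy by blast+
    have "distinct [a, b, c, x, y, z]" using ne h ir by auto
    then have "has_induced G net"
      using copy[of "[a, b, c, x, y, z]"
      "{(0,1), (1,2), (2,0), (0,3), (1,4), (2,5)}"] h rev unfolding net_def by (simp add: small)
    then show False using no by blast
  next
    fix a b c d e assume h: "{a, b, c, d, e} \<subseteq> verts G" "a \<rightarrow>\<^bsub>G\<^esub> b"
      "b \<rightarrow>\<^bsub>G\<^esub> c" "c \<rightarrow>\<^bsub>G\<^esub> d"
      "d \<rightarrow>\<^bsub>G\<^esub> a" "e \<rightarrow>\<^bsub>G\<^esub> a"
      "e \<rightarrow>\<^bsub>G\<^esub> b" "\<not> a \<rightarrow>\<^bsub>G\<^esub> c"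
      "\<not> b \<rightarrow>\<^bsub>G\<^esub> d" "\<not> e \<rightarrow>\<^bsub>G\<^esub> c"
      "\<not> e \<rightarrow>\<^bsub>G\<^esub> d"
    have ne: "a \<noteq> c" "b \<noteq> d" "e \<noteq> c" "e \<noteq> d" using h sy ir by blast+
    have rev: "b \<rightarrow>\<^bsub>G\<^esub> a" "c \<rightarrow>\<^bsub>G\<^esub> b"
      "d \<rightarrow>\<^bsub>G\<^esub> c" "a \<rightarrow>\<^bsub>G\<^esub> d"
      "a \<rightarrow>\<^bsub>G\<^esub> e" "b \<rightarrow>\<^bsub>G\<^esub> e"
      "\<not> c \<rightarrow>\<^bsub>G\<^esub> a" "\<not> d \<rightarrow>\<^bsub>G\<^esub> b"
      "\<not> c \<rightarrow>\<^bsub>G\<^esub> e"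
      "\<not> d \<rightarrow>\<^bsub>G\<^esub> e" using h sy by blast+
    have "distinct [a, b, c, d, e]" using ne h ir by auto
    then have "has_induced G house"
      using copy[of "[a, b, c, d, e]"
      "{(0,1), (1,2), (2,3), (3,0), (4,0), (4,1)}"] h rev unfolding house_def by (simp add: small)
    then show False using no by blast
  next
    fix a b c d e assume h: "{a, b, c, d, e} \<subseteq> verts G" "a \<rightarrow>\<^bsub>G\<^esub> b"
      "b \<rightarrow>\<^bsub>G\<^esub> c" "c \<rightarrow>\<^bsub>G\<^esub> d"
      "e \<rightarrow>\<^bsub>G\<^esub> a" "e \<rightarrow>\<^bsub>G\<^esub> b"
      "e \<rightarrow>\<^bsub>G\<^esub> c" "e \<rightarrow>\<^bsub>G\<^esub> d"
      "\<not> a \<rightarrow>\<^bsub>G\<^esub> c" "\<not> a \<rightarrow>\<^bsub>G\<^esub> d"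
      "\<not> b \<rightarrow>\<^bsub>G\<^esub> d"
    have ne: "a \<noteq> c" "a \<noteq> d" "b \<noteq> d" using h sy ir by blast+
    have rev: "b \<rightarrow>\<^bsub>G\<^esub> a" "c \<rightarrow>\<^bsub>G\<^esub> b"
      "d \<rightarrow>\<^bsub>G\<^esub> c" "a \<rightarrow>\<^bsub>G\<^esub> e"
      "b \<rightarrow>\<^bsub>G\<^esub> e" "c \<rightarrow>\<^bsub>G\<^esub> e"
      "d \<rightarrow>\<^bsub>G\<^esub> e" "\<not> c \<rightarrow>\<^bsub>G\<^esub> a"
      "\<not> d \<rightarrow>\<^bsub>G\<^esub> a"
      "\<not> d \<rightarrow>\<^bsub>G\<^esub> b" using h sy by blast+
    have "distinct [a, b, c, d, e]" using ne h ir by auto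
    then have "has_induced G gem"
      using copy[of "[a, b, c, d, e]"
      "{(0,1), (1,2), (2,3), (4,0), (4,1), (4,2), (4,3)}"] h rev unfolding gem_def by (simp add: small)
    then show False using no by blast
  next
    fix a a' b b' c c' assume h: "{a, a', b, b', c, c'} \<subseteq> verts G" "a \<noteq> a'"
      "b \<noteq> b'" "c \<noteq> c'" "a \<rightarrow>\<^bsub>G\<^esub> b"
      "a \<rightarrow>\<^bsub>G\<^esub> b'" "a \<rightarrow>\<^bsub>G\<^esub> c"
      "a \<rightarrow>\<^bsub>G\<^esub> c'" "a' \<rightarrow>\<^bsub>G\<^esub> b"
      "a' \<rightarrow>\<^bsub>G\<^esub> b'" "a' \<rightarrow>\<^bsub>G\<^esub> c"
      "a' \<rightarrow>\<^bsub>G\<^esub> c'" "b \<rightarrow>\<^bsub>G\<^esub> c"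
      "b \<rightarrow>\<^bsub>G\<^esub> c'" "b' \<rightarrow>\<^bsub>G\<^esub> c"
      "b' \<rightarrow>\<^bsub>G\<^esub> c'" "\<not> a \<rightarrow>\<^bsub>G\<^esub> a'"
      "\<not> b \<rightarrow>\<^bsub>G\<^esub> b'" "\<not> c \<rightarrow>\<^bsub>G\<^esub> c'"
    have ne: "a \<noteq> a'" "b \<noteq> b'" "c \<noteq> c'" using h sy ir by blast+
    have rev: "b \<rightarrow>\<^bsub>G\<^esub> a" "b' \<rightarrow>\<^bsub>G\<^esub> a"
      "c \<rightarrow>\<^bsub>G\<^esub> a" "c' \<rightarrow>\<^bsub>G\<^esub> a"
      "b \<rightarrow>\<^bsub>G\<^esub> a'" "b' \<rightarrow>\<^bsub>G\<^esub> a'"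
      "c \<rightarrow>\<^bsub>G\<^esub> a'" "c' \<rightarrow>\<^bsub>G\<^esub> a'"
      "c \<rightarrow>\<^bsub>G\<^esub> b" "c' \<rightarrow>\<^bsub>G\<^esub> b"
      "c \<rightarrow>\<^bsub>G\<^esub> b'" "c' \<rightarrow>\<^bsub>G\<^esub> b'"
      "\<not> a' \<rightarrow>\<^bsub>G\<^esub> a" "\<not> b' \<rightarrow>\<^bsub>G\<^esub> b"
      "\<not> c' \<rightarrow>\<^bsub>G\<^esub> c" using h sy by blast+
    have "distinct [a, a', b, b', c, c']" using ne h ir by auto
    then have "has_induced G octahedron"
      using copy[of "[a, a', b, b', c, c']"
      "{(0,2), (0,3), (0,4), (0,5), (1,2), (1,3), (1,4), (1,5), (2,4), (2,5), (3,4), (3,5)}"] h rev unfolding octahedron_def by (simp add: small)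
    then show False using no by blast
  next
    fix a b c d e p assume h: "{a, b, c, d, e, p} \<subseteq> verts G" "a \<noteq> c" "b \<noteq> d"
      "a \<rightarrow>\<^bsub>G\<^esub> b" "b \<rightarrow>\<^bsub>G\<^esub> c"
      "c \<rightarrow>\<^bsub>G\<^esub> d" "d \<rightarrow>\<^bsub>G\<^esub> a"
      "e \<rightarrow>\<^bsub>G\<^esub> a" "e \<rightarrow>\<^bsub>G\<^esub> b"
      "e \<rightarrow>\<^bsub>G\<^esub> c" "e \<rightarrow>\<^bsub>G\<^esub> d"
      "e \<rightarrow>\<^bsub>G\<^esub> p" "\<not> a \<rightarrow>\<^bsub>G\<^esub> c"
      "\<not> b \<rightarrow>\<^bsub>G\<^esub> d" "\<not> a \<rightarrow>\<^bsub>G\<^esub> p"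
      "\<not> b \<rightarrow>\<^bsub>G\<^esub> p" "\<not> c \<rightarrow>\<^bsub>G\<^esub> p"
      "\<not> d \<rightarrow>\<^bsub>G\<^esub> p"
    have ne: "a \<noteq> c" "b \<noteq> d" "a \<noteq> p" "b \<noteq> p" "c \<noteq> p"
      "d \<noteq> p" using h sy ir by blast+
    have rev: "b \<rightarrow>\<^bsub>G\<^esub> a" "c \<rightarrow>\<^bsub>G\<^esub> b"
      "d \<rightarrow>\<^bsub>G\<^esub> c" "a \<rightarrow>\<^bsub>G\<^esub> d"
      "a \<rightarrow>\<^bsub>G\<^esub> e" "b \<rightarrow>\<^bsub>G\<^esub> e"
      "c \<rightarrow>\<^bsub>G\<^esub> e" "d \<rightarrow>\<^bsub>G\<^esub> e"
      "p \<rightarrow>\<^bsub>G\<^esub> e" "\<not> c \<rightarrow>\<^bsub>G\<^esub> a"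
      "\<not> d \<rightarrow>\<^bsub>G\<^esub> b" "\<not> p \<rightarrow>\<^bsub>G\<^esub> a"
      "\<not> p \<rightarrow>\<^bsub>G\<^esub> b" "\<not> p \<rightarrow>\<^bsub>G\<^esub> c"
      "\<not> p \<rightarrow>\<^bsub>G\<^esub> d" using h sy by blast+
    have "distinct [a, b, c, d, e, p]" using ne h ir by auto
    then have "has_induced G wheel4_pendant"
      using copy[of "[a, b, c, d, e, p]"
      "{(0,1), (1,2), (2,3), (3,0), (4,0), (4,1), (4,2), (4,3), (4,5)}"] h rev unfolding wheel4_pendant_def by (simp add: small)
    then show False using no by blast
  next
    fix a b c d p q assume h: "{a, b, c, d, p, q} \<subseteq> verts G" "c \<noteq> d"
      "a \<rightarrow>\<^bsub>G\<^esub> b" "a \<rightarrow>\<^bsub>G\<^esub> c"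
      "a \<rightarrow>\<^bsub>G\<^esub> d" "b \<rightarrow>\<^bsub>G\<^esub> c"
      "b \<rightarrow>\<^bsub>G\<^esub> d" "a \<rightarrow>\<^bsub>G\<^esub> p"
      "b \<rightarrow>\<^bsub>G\<^esub> q" "\<not> c \<rightarrow>\<^bsub>G\<^esub> d"
      "\<not> a \<rightarrow>\<^bsub>G\<^esub> q" "\<not> b \<rightarrow>\<^bsub>G\<^esub> p"
      "\<not> c \<rightarrow>\<^bsub>G\<^esub> p" "\<not> c \<rightarrow>\<^bsub>G\<^esub> q"
      "\<not> d \<rightarrow>\<^bsub>G\<^esub> p" "\<not> d \<rightarrow>\<^bsub>G\<^esub> q"
      "\<not> p \<rightarrow>\<^bsub>G\<^esub> q"
    have ne: "c \<noteq> d" "a \<noteq> q" "b \<noteq> p" "c \<noteq> p" "c \<noteq> q" "d \<noteq> p"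
      "d \<noteq> q" "p \<noteq> q" using h sy ir by blast+
    have rev: "b \<rightarrow>\<^bsub>G\<^esub> a" "c \<rightarrow>\<^bsub>G\<^esub> a"
      "d \<rightarrow>\<^bsub>G\<^esub> a" "c \<rightarrow>\<^bsub>G\<^esub> b"
      "d \<rightarrow>\<^bsub>G\<^esub> b" "p \<rightarrow>\<^bsub>G\<^esub> a"
      "q \<rightarrow>\<^bsub>G\<^esub> b" "\<not> d \<rightarrow>\<^bsub>G\<^esub> c"
      "\<not> q \<rightarrow>\<^bsub>G\<^esub> a" "\<not> p \<rightarrow>\<^bsub>G\<^esub> b"
      "\<not> p \<rightarrow>\<^bsub>G\<^esub> c" "\<not> q \<rightarrow>\<^bsub>G\<^esub> c"
      "\<not> p \<rightarrow>\<^bsub>G\<^esub> d" "\<not> q \<rightarrow>\<^bsub>G\<^esub> d"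
      "\<not> q \<rightarrow>\<^bsub>G\<^esub> p" using h sy by blast+
    have "distinct [a, b, c, d, p, q]" using ne h ir by auto
    then have "has_induced G diamond_two_pendants"
      using copy[of "[a, b, c, d, p, q]"
      "{(0,1), (0,2), (0,3), (1,2), (1,3), (0,4), (1,5)}"] h rev unfolding diamond_two_pendants_def by (simp add: small)
    then show False using no by blast
  qed simp
qed

section \<open>The characterization\<close>

text \<open>In the complement, the diagonals of an induced 4-cycle are two anticomplete edges, and
  the absence of isolated vertices becomes the absence of universal ones. Complementing twice
  returns \<open>E\<close> because \<open>E\<close> is irreflexive.\<close>

lemma (in special_free) special_partition_exists:
  assumes noiso: "\<And>x. x \<in> V \<Longrightarrow> \<exists>y\<in>V. E x y"
  shows "\<exists>A D W. V = A \<union> D \<union> W \<and> special_partition E A D W"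
proof (cases "\<exists>a\<in>V. \<exists>b\<in>V. \<exists>c\<in>V. \<exists>d\<in>V. E a b \<and> E b c \<and> E c d \<and> E d a \<and> \<not> E a c \<and> \<not> E b d \<and> a \<noteq> c \<and> b \<noteq> d")
  case False
  show ?thesis
  proof (rule special_partition_no_C4[OF _ noiso])
    show False if "a \<in> V" "b \<in> V" "c \<in> V" "d \<in> V" "E a b" "E b c" "E c d" "E d a" "\<not> E a c" "\<not> E b d" "a \<noteq> c" "b \<noteq> d"
      for a b c d
      using False that by blast
  qed
next
  case True
  then obtain a b c d where h: "{a, b, c, d} \<subseteq> V" "E a b" "E b c" "E c d" "E d a" "\<not> E a c" "\<not> E b d" "a \<noteq> c" "b \<noteq> d"
    by auto
  interpret co: co_special_free "\<lambda>x y. x \<noteq> y \<and> \<not> E x y" V by (rule co_special_free)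
  have "\<exists>A D W. V = A \<union> D \<union> W \<and> special_partition (\<lambda>x y. x \<noteq> y \<and> \<not> (x \<noteq> y \<and> \<not> E x y)) A D W"
  proof (rule co.special_partition_2K2)
    show "{a, c, b, d} \<subseteq> V" using h by auto
    show "\<exists>y\<in>V. y \<noteq> x \<and> \<not> (x \<noteq> y \<and> \<not> E x y)" if x: "x \<in> V" for x
    proof -
      obtain y where "y \<in> V" "E x y" using noiso[OF x] by blast
      moreover from this have "y \<noteq> x" using irr by blast
      ultimately show ?thesis by blast
    qed
  qed (use h sym in auto)
  moreover have "(\<lambda>x y. x \<noteq> y \<and> \<not> (x \<noteq> y \<and> \<not> E x y)) = E" using irr by (intro ext) auto
  ultimately show ?thesis by simp
qed

theorem theorem3:
  fixes G :: "('a, 'b) pre_digraph"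
  assumes "graph G"
  shows "special_two_threshold G \<longleftrightarrow>
    \<not> has_induced G two_K2 \<and>
    \<not> has_induced G C5 \<and>
    \<not> has_induced G net \<and>
    \<not> has_induced G house \<and>
    \<not> has_induced G gem \<and>
    \<not> has_induced G octahedron \<and>
    \<not> has_induced G wheel4_pendant \<and>
    \<not> has_induced G diamond_two_pendants"
  (is "_ \<longleftrightarrow> ?free")
proof
  assume "special_two_threshold G"
  then show ?free
    using special_free_imp_no_induced[OF assms special_imp_special_free[OF assms]] by blast
next
  interpret graph G by fact
  assume ?free
  then have sf: "special_free (\<lambda>x y. x \<rightarrow>\<^bsub>G\<^esub> y) (verts G)"
    using no_induced_imp_special_free[OF assms] by blast
  \<comment> \<open>The partition is constructed for graphs in which every vertex has a neighbour.
    Isolated vertices are set aside and become the set \<open>Z\<close> of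
    \<open>special_partition_imp_special\<close>; removing them isolates no other vertex.\<close>
  define U where "U = {x \<in> verts G. \<exists>y\<in>verts G. x \<rightarrow>\<^bsub>G\<^esub> y}"
  have "special_free (\<lambda>x y. x \<rightarrow>\<^bsub>G\<^esub> y) U"
    using special_free_subset[OF sf] by (simp add: U_def)
  then interpret U: special_free "\<lambda>x y. x \<rightarrow>\<^bsub>G\<^esub> y" U .
  have "\<exists>y\<in>U. x \<rightarrow>\<^bsub>G\<^esub> y" if "x \<in> U" for x using that U.sym by (auto simp: U_def)
  then obtain A D W where ADW: "U = A \<union> D \<union> W" "special_partition (\<lambda>x y. x \<rightarrow>\<^bsub>G\<^esub> y) A D W"
    using U.special_partition_exists by blast
  show "special_two_threshold G"
  proof (rule special_partition_imp_special[OF assms _ _ _ ADW(2)])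
    show "verts G = A \<union> D \<union> W \<union> (verts G - U)" using ADW(1) by (auto simp: U_def)
    show "\<not> z \<rightarrow>\<^bsub>G\<^esub> x" if "z \<in> verts G - U" for z x
      using that adj_in_verts by (auto simp: U_def)
    show "(verts G - U) \<inter> (A \<union> D \<union> W) = {}" using ADW(1) by blast
  qed
qed

end
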